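(* Let $a>1$ be a real number and let $$F_a(z)=\sum_{k=0}^\infty \frac{z^k}{(a^k+1)(a^{k-1}+1)\cdots(a+1)}$$ (the $k=0$ term being $1$). Then the entire function $F_a$ belongs to the Laguerre-Pólya class if and only if there exists $z_0\in(-(a^2+1),-(a+1))$ such that $F_a(z_0)\le 0$.
   Context: A real entire function $f$ is said to be in the Laguerre-Pólya class if it can be expressed in the form $$f(x)=c x^n e^{-\alpha x^2+\beta x}\prod_{k=1}^\infty\left(1-\frac{x}{x_k}\right)e^{x x_k^{-1}},$$ where $c,\alpha,\beta,x_k\in\mathbb{R}$, $x_k\neq 0$, $\alpha\ge 0$, $n$ is a nonnegative integer and $\sum_{k=1}^\infty x_k^{-2}<\infty$; the product may be finite or empty (in the latter case it equals $1$). *)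

theory Defs
  imports "HOL-Complex_Analysis.Complex_Analysis"
begin

definition real_entire :: "(complex \<Rightarrow> complex) \<Rightarrow> bool" where
  "real_entire f \<longleftrightarrow> f holomorphic_on UNIV \<and> (\<forall>x::real. f (of_real x) \<in> \<real>)"

(* The set I indexes the factors: I infinite gives an infinite product, I finite a finite one,
   I = {} the empty product.  By absolute convergence the enumeration by nat is immaterial.
   Indices outside I contribute the factor 1, and has_prod permits the product to vanish
   at the zeros x k. *)
definition laguerre_polya :: "(complex \<Rightarrow> complex) \<Rightarrow> bool" where
  "laguerre_polya f \<longleftrightarrow> real_entire f \<and>
    (\<exists>(c::real) (n::nat) (\<alpha>::real) (\<beta>::real) (I::nat set) (x::nat \<Rightarrow> real).
       \<alpha> \<ge> 0 \<and> (\<forall>k\<in>I. x k \<noteq> 0) \<and> (\<lambda>k. 1 / (x k)\<^sup>2) summable_on I \<and>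
       (\<forall>z. \<exists>P. (\<lambda>k. if k \<in> I
                     then (1 - z / of_real (x k)) * exp (z / of_real (x k)) else 1) has_prod P \<and>
          f z = of_real c * z ^ n * exp (- of_real \<alpha> * z\<^sup>2 + of_real \<beta> * z) * P))"

definition F :: "real \<Rightarrow> complex \<Rightarrow> complex" where
  "F a z = (\<Sum>k. z ^ k / of_real (\<Prod>j=1..k. (a ^ j + 1)))"

lemma F_summable:
  assumes "a > 1"
  shows "summable (\<lambda>k. z ^ k / of_real (\<Prod>j=1..k. (a ^ j + 1)) :: complex)"
proof -
  obtain N where N: "2 * norm z < a ^ N"
    using real_arch_pow[OF assms] by blast
  show ?thesis
  proof (rule summable_ratio_test[where c = "1/2" and N = N])
    fix k assume k: "k \<ge> N"
    have pos: "(\<Prod>j=1..k. (a ^ j + 1)) > 0"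
      using assms by (intro prod_pos) (auto intro!: add_pos_pos)
    have "a ^ N \<le> a ^ Suc k"
      using assms k by (intro power_increasing) auto
    with N have le: "2 * norm z \<le> a ^ Suc k + 1" by linarith
    have q: "a ^ Suc k + 1 > 0" using assms by (intro add_pos_pos) auto
    have nm: "norm (z ^ m / of_real (\<Prod>j=1..m. (a ^ j + 1))) = norm z ^ m / (\<Prod>j=1..m. (a ^ j + 1))" for m
    proof -
      have "(\<Prod>j=1..m. (a ^ j + 1)) > 0"
        using assms by (intro prod_pos) (auto intro!: add_pos_pos)
      then show ?thesis by (simp only: norm_divide norm_power norm_of_real abs_of_pos)
    qed
    have "norm z / (a ^ Suc k + 1) \<le> 1/2" using le q by (simp add: field_simps)
    then have "(norm z / (a ^ Suc k + 1)) * (norm z ^ k / (\<Prod>j=1..k. (a ^ j + 1)))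
        \<le> 1/2 * (norm z ^ k / (\<Prod>j=1..k. (a ^ j + 1)))"
      using pos by (intro mult_right_mono) auto
    then show "norm (z ^ Suc k / of_real (\<Prod>j=1..Suc k. (a ^ j + 1)))
       \<le> 1/2 * norm (z ^ k / of_real (\<Prod>j=1..k. (a ^ j + 1)))"
      unfolding nm by (simp add: mult_ac)
  qed simp
qed

lemma F_real_entire:
  assumes "a > 1"
  shows "real_entire (F a)"
  unfolding real_entire_def
proof (intro conjI allI)
  define c :: "nat \<Rightarrow> complex" where "c k = 1 / of_real (\<Prod>j=1..k. (a ^ j + 1))" for k
  have s: "summable (\<lambda>k. c k * z ^ k :: complex)" for z
    using F_summable[OF assms, of z] by (simp add: c_def)
  have eq: "F a = (\<lambda>z. \<Sum>k. c k * z ^ k)"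
    by (rule ext) (simp add: F_def c_def)
  have "(F a has_field_derivative (\<Sum>n. diffs c n * z ^ n)) (at z)" for z
    unfolding eq by (rule termdiffs_strong_converges_everywhere) (rule s)
  then show "F a holomorphic_on UNIV"
    by (auto simp: holomorphic_on_open)
next
  fix x :: real
  have "summable (\<lambda>k. of_real (x ^ k / (\<Prod>j=1..k. (a ^ j + 1))) :: complex)"
    using F_summable[OF assms, of "of_real x"] by simp
  then have "summable (\<lambda>k. x ^ k / (\<Prod>j=1..k. (a ^ j + 1)))"
    unfolding summable_of_real_iff .
  then have "F a (of_real x) = of_real (\<Sum>k. x ^ k / (\<Prod>j=1..k. (a ^ j + 1)))"
    unfolding F_def by (simp add: suminf_of_real)
  then show "F a (of_real x) \<in> \<real>" by simp
qed

end

theory Submission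
  imports Defs "HOL-Real_Asymp.Real_Asymp"
begin

text \<open>
  Everything rests on the functional equation F(az) = 2 + (z - 1) F(z); write p = a + 1,
  q = a^2 + 1, r = a^3 + 1.

  If F is in the Laguerre-Polya class, its zeros are negative, say -1/c with c > 0, and comparing
  ln F(x) with its Taylor polynomial at 0 expresses the sums S2, S3 of c^2, c^3 through the first
  three coefficients of F. The inequality S2^2 \<le> S3 / p (Cauchy-Schwarz) gives q > 3 p. If F had
  no zero in the interval (-q, -p), then every c would be at most 1/q, so S3 \<le> S2 / q, and the
  two inequalities together give (q - 2 p)(q - 3 p) \<le> 0, a contradiction.

  Conversely, F(-x) \<le> 0 for some x between p and q forces a > 3, and the functional equation
  propagates the sign: F(-x a^k) alternates. This gives zeros -t(k) with
  a^k \<le> t(k) \<le> q a^k. On the circle of radius a^(n+2), F divided by the first n factors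
  1 + z / t(k) is o(a^(2n)), so by Cauchy's estimates the quotients converge to a polynomial of
  degree at most 1. Its root, if any, is real.
\<close>

section \<open>The series and its functional equation\<close>

definition Fden :: "real \<Rightarrow> nat \<Rightarrow> real" where
  "Fden a k = (\<Prod>j=1..k. (a ^ j + 1))"

definition Freal :: "real \<Rightarrow> real \<Rightarrow> real" where
  "Freal a x = (\<Sum>k. x ^ k / Fden a k)"

lemma Fden_0 [simp]: "Fden a 0 = 1"
  and Fden_Suc: "Fden a (Suc k) = (a ^ Suc k + 1) * Fden a k"
  by (auto simp: Fden_def)

context
  fixes a :: real
  assumes a: "a > 1"
begin

lemma power_add_one_pos: "a ^ k + 1 > 0"
  using a by (intro add_pos_pos) auto

lemma Fden_pos: "Fden a k > 0"
  unfolding Fden_def by (intro prod_pos) (auto intro: power_add_one_pos)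

lemma F_sums: "(\<lambda>k. z ^ k / of_real (Fden a k)) sums F a z"
  using F_summable[OF a, of z] unfolding F_def Fden_def by (rule summable_sums)

lemma Freal_summable: "summable (\<lambda>k. x ^ k / Fden a k)"
proof -
  have "summable (\<lambda>k. of_real (x ^ k / Fden a k) :: complex)"
    using F_sums[of "of_real x"] by (simp add: sums_iff)
  thus ?thesis unfolding summable_of_real_iff .
qed

lemma Freal_sums: "(\<lambda>k. x ^ k / Fden a k) sums Freal a x"
  using Freal_summable unfolding Freal_def by (rule summable_sums)

lemma F_of_real: "F a (of_real x) = of_real (Freal a x)"
proof -
  have "(\<lambda>k. complex_of_real (x ^ k / Fden a k)) sums of_real (Freal a x)"
    by (intro sums_of_real Freal_sums)
  thus ?thesis
    using F_sums[of "of_real x"] sums_unique2 by simp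
qed

text \<open>Because \<open>Fden a (Suc k)\<close> is \<open>a ^ Suc k + 1\<close> times
  \<open>Fden a k\<close>, z times the k-th term of F(z) is the sum of the (k+1)-st terms of F(az)
  and F(z). The two constant terms missing from the shifted sums give the 2.\<close>

lemma F_functional: "F a (of_real a * z) = 2 + (z - 1) * F a z"
proof -
  have d: "complex_of_real (Fden a (Suc k)) = (of_real a ^ Suc k + 1) * of_real (Fden a k)" for k
    by (simp add: Fden_Suc)
  have nz: "complex_of_real (Fden a k) \<noteq> 0" for k
    using Fden_pos[of k] by simp
  have nz': "complex_of_real a ^ Suc k + 1 \<noteq> 0" for k
    using nz[of "Suc k"] unfolding d by auto
  have "(\<lambda>k. z * (z ^ k / of_real (Fden a k))) sums (z * F a z)"
    by (intro sums_mult F_sums)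
  moreover have "z * (z ^ k / of_real (Fden a k))
      = (of_real a * z) ^ Suc k / of_real (Fden a (Suc k)) + z ^ Suc k / of_real (Fden a (Suc k))" for k
  proof -
    have "(of_real a * z) ^ Suc k + z ^ Suc k = (of_real a ^ Suc k + 1) * (z * z ^ k)"
      by (simp add: power_mult_distrib algebra_simps)
    thus ?thesis using nz[of k] nz'[of k] by (simp add: d flip: add_divide_distrib)
  qed
  ultimately have "(\<lambda>k. (of_real a * z) ^ Suc k / of_real (Fden a (Suc k)) + z ^ Suc k / of_real (Fden a (Suc k))) sums (z * F a z)"
    by simp
  hence "(\<lambda>k. (of_real a * z) ^ k / of_real (Fden a k) + z ^ k / of_real (Fden a k)) sums (z * F a z + 2)"
    by (subst (asm) sums_Suc_iff) simp
  with sums_add[OF F_sums[of "of_real a * z"] F_sums[of z]]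
  have "F a (of_real a * z) + F a z = z * F a z + 2"
    using sums_unique2 by blast
  thus ?thesis by (simp add: algebra_simps)
qed

lemma Freal_functional: "Freal a (a * x) = 2 + (x - 1) * Freal a x"
proof -
  have "complex_of_real (Freal a (a * x)) = of_real (2 + (x - 1) * Freal a x)"
    using F_functional[of "of_real x"] by (simp flip: F_of_real)
  thus ?thesis unfolding of_real_eq_iff .
qed

lemma Freal_0: "Freal a 0 = 1"
  using Freal_functional[of 0] by simp

lemma norm_F_le: "norm (F a z) \<le> Freal a (norm z)"
proof -
  have "norm (z ^ k / of_real (Fden a k)) = norm z ^ k / Fden a k" for k
    using Fden_pos[of k] by (simp add: norm_divide norm_power)
  thus ?thesis
    using Freal_summable[of "norm z"] summable_norm[of "\<lambda>k. z ^ k / of_real (Fden a k)"]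
      F_sums[of z] Freal_def by (simp add: sums_iff)
qed

section \<open>Growth on the positive axis and sign bounds on the negative axis\<close>

lemma Freal_ge_partial:
  assumes "x \<ge> 0"
  shows "(\<Sum>k<n. x ^ k / Fden a k) \<le> Freal a x"
  unfolding Freal_def using assms Fden_pos
  by (intro sum_le_suminf Freal_summable) (auto intro!: divide_nonneg_pos)

lemma Freal_ge_1: "x \<ge> 0 \<Longrightarrow> Freal a x \<ge> 1"
  using Freal_ge_partial[of x 1] by simp

text \<open>The first two terms of the series give F(x) \<ge> 2 for x \<ge> a + 1, and then F(ax) =
  2 + (x - 1) F(x) \<le> x F(x). Iteration along the powers of a yields the product.\<close>

lemma Freal_power_le:
  assumes "a + 1 \<le> a ^ m"
  shows "Freal a (a ^ (n + m)) \<le> Freal a (a ^ m) * (\<Prod>k<n. a ^ (k + m))"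
proof (induction n)
  case (Suc n)
  let ?x = "a ^ (n + m)"
  have "a ^ m \<le> ?x" using a by (intro power_increasing) auto
  hence x: "?x \<ge> a + 1" using assms by simp
  have "?x / (a + 1) \<ge> 1" using x a by (simp add: field_simps)
  moreover have "1 + ?x / (a + 1) \<le> Freal a ?x"
    using Freal_ge_partial[of ?x 2] a by (simp add: numeral_2_eq_2 Fden_def)
  ultimately have "Freal a ?x \<ge> 2" by linarith
  hence "Freal a (a * ?x) \<le> ?x * Freal a ?x"
    unfolding Freal_functional by (simp add: algebra_simps)
  also have "\<dots> \<le> ?x * (Freal a (a ^ m) * (\<Prod>k<n. a ^ (k + m)))"
    using Suc.IH a by (intro mult_left_mono) auto
  finally show ?case by (simp add: mult_ac)
qed simp

text \<open>The ratio of consecutive terms is x / (a^(k+1) + 1) in absolute value, hence at most 1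
  from index 2m on. The remaining alternating series starts with a nonnegative term, so its sum is
  nonnegative by Leibniz's criterion.\<close>

lemma Freal_minus_ge:
  assumes "0 \<le> x" "x \<le> a ^ (2 * m + 1) + 1"
  shows "(\<Sum>k<2*m. (- x) ^ k / Fden a k) \<le> Freal a (- x)"
proof -
  define u where "u k = x ^ (k + 2 * m) / Fden a (k + 2 * m)" for k
  have u0: "u k \<ge> 0" for k
    using assms Fden_pos[of "k + 2 * m"] by (simp add: u_def)
  have mono: "u (Suc k) \<le> u k" for k
  proof -
    have "x / (a ^ (Suc (k + 2 * m)) + 1) \<le> 1"
    proof -
      have "a ^ (2 * m + 1) \<le> a ^ (Suc (k + 2 * m))" using a by (intro power_increasing) auto
      thus ?thesis using assms power_add_one_pos[of "Suc (k + 2 * m)"] by (simp add: divide_le_eq)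
    qed
    hence "x / (a ^ (Suc (k + 2 * m)) + 1) * u k \<le> 1 * u k"
      using u0 by (intro mult_right_mono) auto
    thus ?thesis by (simp add: u_def Fden_Suc)
  qed
  have "(\<lambda>k. x ^ k / Fden a k) \<longlonglongrightarrow> 0"
    by (rule summable_LIMSEQ_zero[OF Freal_summable])
  hence lim: "u \<longlonglongrightarrow> 0"
    unfolding u_def by (rule LIMSEQ_ignore_initial_segment)
  have "0 \<le> (\<Sum>k. (- 1) ^ k * u k)"
    using summable_Leibniz'(2)[OF lim u0 mono, of 0] by simp
  also have "(\<lambda>k. (- 1) ^ k * u k) = (\<lambda>k. (- x) ^ (k + 2 * m) / Fden a (k + 2 * m))"
    by (simp add: u_def power_add power_minus[of x] power_mult mult.assoc)
  also have "suminf \<dots> = Freal a (- x) - (\<Sum>k<2*m. (- x) ^ k / Fden a k)"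
    unfolding Freal_def by (rule suminf_minus_initial_segment[OF Freal_summable])
  finally show ?thesis by simp
qed

lemma Freal_minus_ge_cubic:
  assumes "0 \<le> x" "x \<le> a ^ 2 + 1"
  shows "1 - x / (a + 1) + x ^ 2 / ((a + 1) * (a ^ 2 + 1))
           - x ^ 3 / ((a + 1) * (a ^ 2 + 1) * (a ^ 3 + 1)) \<le> Freal a (- x)"
proof -
  have "a ^ 2 \<le> a ^ 5" using a by (intro power_increasing) auto
  hence "(\<Sum>k<2*2. (- x) ^ k / Fden a k) \<le> Freal a (- x)"
    using assms by (intro Freal_minus_ge) auto
  moreover have "(\<Sum>k<4. (- x) ^ k / Fden a k) = 1 - x / (a + 1) + x ^ 2 / ((a + 1) * (a ^ 2 + 1))
           - x ^ 3 / ((a + 1) * (a ^ 2 + 1) * (a ^ 3 + 1))"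
    by (simp add: eval_nat_numeral Fden_Suc mult_ac)
  ultimately show ?thesis by simp
qed

text \<open>In the cubic lower bound, 1 - x / (a + 1) is nonnegative, and for x > 0 the square term
  outweighs the cubic one because x < a^3 + 1.\<close>

lemma Freal_minus_pos:
  assumes "0 \<le> x" "x \<le> a + 1"
  shows "Freal a (- x) > 0"
proof (cases "x = 0")
  case False
  hence x: "x > 0" using assms by simp
  have aa: "a ^ 2 > a" "a ^ 3 > a" using a power_strict_increasing[of 1 _ a] by auto
  have "x ^ 3 / ((a + 1) * (a ^ 2 + 1) * (a ^ 3 + 1)) = x ^ 2 / ((a + 1) * (a ^ 2 + 1)) * (x / (a ^ 3 + 1))"
    by (simp add: eval_nat_numeral)
  also have "\<dots> < x ^ 2 / ((a + 1) * (a ^ 2 + 1)) * 1"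
    using x a aa assms by (intro mult_strict_left_mono) (auto simp: divide_less_eq intro!: divide_pos_pos mult_pos_pos)
  finally have "x ^ 3 / ((a + 1) * (a ^ 2 + 1) * (a ^ 3 + 1)) < x ^ 2 / ((a + 1) * (a ^ 2 + 1))" by simp
  moreover have "x / (a + 1) \<le> 1" using assms a by (simp add: field_simps)
  ultimately show ?thesis using Freal_minus_ge_cubic[of x] assms aa by simp
qed (simp add: Freal_0)

(* With q\<^sub>2 = (a\<^sup>2 + 1) / (a + 1), q\<^sub>3 = (a\<^sup>3 + 1) / (a\<^sup>2 + 1) and w = x / (a\<^sup>2 + 1), the cubic lower bound
   is 1 - q\<^sub>2 (w - w\<^sup>2 + w\<^sup>3 / q\<^sub>3); for q\<^sub>3 \<le> 3 the bracket increases up to 1 / q\<^sub>3 at w = 1, and q\<^sub>2 < q\<^sub>3. *)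
lemma Freal_minus_nonpos_imp:
  assumes "0 \<le> x" "x \<le> a ^ 2 + 1" "Freal a (- x) \<le> 0"
  shows "a > 3"
proof (rule ccontr)
  assume "\<not> a > 3"
  hence a3: "a \<le> 3" by simp
  define w r q where "w = x / (a ^ 2 + 1)" and "r = (a ^ 2 + 1) / (a ^ 3 + 1)" and "q = (a ^ 2 + 1) / (a + 1)"
  have a2: "a ^ 2 + 1 > 0" and a3p: "a ^ 3 + 1 > 0" by (rule power_add_one_pos)+
  have x: "x = w * (a ^ 2 + 1)" using a2 by (simp add: w_def)
  have w: "0 \<le> w" "w \<le> 1" using assms a2 by (auto simp: w_def divide_le_eq)
  have "a ^ 2 * a \<le> a ^ 2 * 3" using a3 by (intro mult_left_mono) auto
  hence "a ^ 3 + 1 \<le> 3 * (a ^ 2 + 1)" by (simp add: eval_nat_numeral)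
  hence r: "r \<ge> 1 / 3" using a3p by (simp add: r_def field_simps)
  have q: "q > 0" using a a2 by (simp add: q_def)
  have "(a ^ 3 + 1) * (a + 1) - (a ^ 2 + 1) ^ 2 = a * (a - 1) ^ 2"
    by algebra
  also have "\<dots> > 0" using a by simp
  finally have "(a ^ 2 + 1) ^ 2 < (a ^ 3 + 1) * (a + 1)" by simp
  moreover have "q * r = (a ^ 2 + 1) ^ 2 / ((a ^ 3 + 1) * (a + 1))"
    by (simp add: q_def r_def power2_eq_square mult.commute)
  ultimately have qr: "q * r < 1"
    using a a3p by simp
  have "(1 - w) ^ 3 \<ge> 0" using w by simp
  \<comment> \<open>The distance to the value r at w = 1 splits into two nonnegative terms, which
    gives the maximum on [0, 1] without differentiation.\<close>
  have "r - (w - w ^ 2 + r * w ^ 3) = (r - 1/3) * (1 - w ^ 3) + (1 - w) ^ 3 / 3"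
    by (simp add: power2_eq_square power3_eq_cube field_simps)
  moreover have "(r - 1/3) * (1 - w ^ 3) \<ge> 0"
    using r w by (intro mult_nonneg_nonneg) (auto simp: power_le_one)
  ultimately have "w - w ^ 2 + r * w ^ 3 \<le> r"
    using \<open>(1 - w) ^ 3 \<ge> 0\<close> by linarith
  hence "q * (w - w ^ 2 + r * w ^ 3) \<le> q * r" using q by (intro mult_left_mono) auto
  hence "1 - q * (w - w ^ 2 + r * w ^ 3) > 0" using qr by linarith
  also have "1 - q * (w - w ^ 2 + r * w ^ 3) = 1 - x / (a + 1) + x ^ 2 / ((a + 1) * (a ^ 2 + 1))
           - x ^ 3 / ((a + 1) * (a ^ 2 + 1) * (a ^ 3 + 1))"
  proof -
    have ap: "a + 1 \<noteq> 0" using a by simp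
    have "x / (a + 1) = q * w" by (simp add: x q_def)
    moreover have "(w * B) ^ 2 / (A * B) = B / A * w ^ 2" if "A \<noteq> 0" "B \<noteq> 0" for A B :: real
      using that by (simp add: power2_eq_square)
    from this[of "a + 1" "a ^ 2 + 1"] have "x ^ 2 / ((a + 1) * (a ^ 2 + 1)) = q * w ^ 2"
      using ap a2 unfolding x q_def by simp
    moreover have "(w * B) ^ 3 / (A * B * C) = B / A * (B / C * w ^ 3)"
      if "A \<noteq> 0" "B \<noteq> 0" "C \<noteq> 0" for A B C :: real
      using that by (simp add: power3_eq_cube)
    from this[of "a + 1" "a ^ 2 + 1" "a ^ 3 + 1"]
    have "x ^ 3 / ((a + 1) * (a ^ 2 + 1) * (a ^ 3 + 1)) = q * (r * w ^ 3)"
      using ap a2 a3p unfolding x q_def r_def by simp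
    ultimately show ?thesis by (simp add: algebra_simps)
  qed
  also have "\<dots> \<le> Freal a (- x)"
    using assms by (intro Freal_minus_ge_cubic) auto
  finally show False using assms by simp
qed

end

section \<open>Power sums of the zeros\<close>

text \<open>The derivatives of the logarithm minus the two polynomials are -x^3 / (1 + x) and x^4 /
  (1 + x). The bounds hold on the whole half-line, so that they can be summed over all factors of an
  infinite product.\<close>

lemma ln_one_plus_bounds:
  fixes y :: real
  assumes "y \<ge> 0"
  shows "ln (1 + y) \<le> y - y^2/2 + y^3/3"
    and "y - y^2/2 + y^3/3 - y^4/4 \<le> ln (1 + y)"
proof -
  have "ln (1 + 0) - (0 - 0^2/2 + 0^3/3) \<ge> ln (1 + y) - (y - y^2/2 + y^3/3)"
  proof (rule DERIV_nonpos_imp_nonincreasing[OF assms])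
    fix x :: real assume x: "0 \<le> x" "x \<le> y"
    have "((\<lambda>y. ln (1 + y) - (y - y^2/2 + y^3/3)) has_real_derivative (1 / (1 + x) - (1 - x + x^2))) (at x)"
      using x by (auto intro!: derivative_eq_intros)
    moreover have "1 / (1 + x) - (1 - x + x^2) = - (x^3 / (1 + x))"
      using x by (simp add: field_simps power2_eq_square power3_eq_cube)
    ultimately show "\<exists>d. ((\<lambda>y. ln (1 + y) - (y - y^2/2 + y^3/3)) has_real_derivative d) (at x) \<and> d \<le> 0"
      using x by (intro exI[of _ "- (x^3 / (1 + x))"]) auto
  qed
  thus "ln (1 + y) \<le> y - y^2/2 + y^3/3" by simp
  have "ln (1 + 0) - (0 - 0^2/2 + 0^3/3 - 0^4/4) \<le> ln (1 + y) - (y - y^2/2 + y^3/3 - y^4/4)"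
  proof (rule DERIV_nonneg_imp_nondecreasing[OF assms])
    fix x :: real assume x: "0 \<le> x" "x \<le> y"
    have "((\<lambda>y. ln (1 + y) - (y - y^2/2 + y^3/3 - y^4/4)) has_real_derivative (1 / (1 + x) - (1 - x + x^2 - x^3))) (at x)"
      using x by (auto intro!: derivative_eq_intros)
    moreover have "1 / (1 + x) - (1 - x + x^2 - x^3) = x^4 / (1 + x)"
      using x by (simp add: field_simps power2_eq_square power3_eq_cube power4_eq_xxxx)
    ultimately show "\<exists>d. ((\<lambda>y. ln (1 + y) - (y - y^2/2 + y^3/3 - y^4/4)) has_real_derivative d) (at x) \<and> d \<ge> 0"
      using x by (intro exI[of _ "x^4 / (1 + x)"]) auto
  qed
  thus "y - y^2/2 + y^3/3 - y^4/4 \<le> ln (1 + y)" by simp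
qed

lemma eq_0_if_abs_le_linear:
  fixes d C :: real
  assumes "\<And>x. 0 < x \<Longrightarrow> x \<le> 1 \<Longrightarrow> \<bar>d\<bar> \<le> C * x"
  shows "d = 0"
proof -
  have "\<bar>d\<bar> \<le> 0"
  proof (rule tendsto_lowerbound)
    show "((\<lambda>x. C * x) \<longlongrightarrow> 0) (at_right 0)" by (auto intro!: tendsto_eq_intros)
    show "eventually (\<lambda>x. \<bar>d\<bar> \<le> C * x) (at_right 0)"
      unfolding eventually_at_right_field using assms by (intro exI[of _ 1]) auto
  qed simp
  thus ?thesis by simp
qed

text \<open>Divide by x, x^2 and x^3 in turn and let x tend to 0 from the right. This compares
  Taylor coefficients by inequalities alone, without differentiating an infinite product.\<close>

lemma cubic_eq_0_if_quartic_bound: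
  fixes d1 d2 d3 K :: real
  assumes "\<And>x. 0 < x \<Longrightarrow> x \<le> 1 \<Longrightarrow> \<bar>d1 * x + d2 * x^2 + d3 * x^3\<bar> \<le> K * x^4"
  shows "d1 = 0 \<and> d2 = 0 \<and> d3 = 0"
proof -
  have K: "K \<ge> 0" using assms[of 1] by simp
  have 1: "d1 = 0"
  proof (rule eq_0_if_abs_le_linear)
    fix x :: real assume x: "0 < x" "x \<le> 1"
    have "x * \<bar>d1 + x * (d2 + d3 * x)\<bar> \<le> x * (K * x^3)"
      using assms[OF x] x by (simp add: abs_mult_pos' algebra_simps power2_eq_square power3_eq_cube power4_eq_xxxx)
    hence "\<bar>d1 + x * (d2 + d3 * x)\<bar> \<le> K * x^3" using x by simp
    hence "\<bar>d1\<bar> \<le> K * x^3 + \<bar>x * (d2 + d3 * x)\<bar>" by linarith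
    also have "\<bar>x * (d2 + d3 * x)\<bar> \<le> x * (\<bar>d2\<bar> + \<bar>d3\<bar> * 1)"
      unfolding abs_mult using x
      by (intro mult_mono order.trans[OF abs_triangle_ineq] add_mono) (auto simp: abs_mult intro!: mult_left_le)
    also have "K * x^3 \<le> K * x" using x K power_decreasing[of 1 3 x] by (intro mult_left_mono) auto
    finally show "\<bar>d1\<bar> \<le> (K + \<bar>d2\<bar> + \<bar>d3\<bar>) * x" by (simp add: algebra_simps)
  qed
  have 2: "d2 = 0"
  proof (rule eq_0_if_abs_le_linear)
    fix x :: real assume x: "0 < x" "x \<le> 1"
    have "x^2 * \<bar>d2 + d3 * x\<bar> \<le> x^2 * (K * x^2)"
      using assms[OF x] x 1 by (simp add: abs_mult_pos' algebra_simps power2_eq_square power3_eq_cube power4_eq_xxxx)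
    hence "\<bar>d2 + d3 * x\<bar> \<le> K * x^2" using x by simp
    hence "\<bar>d2\<bar> \<le> K * x^2 + \<bar>d3\<bar> * x" using x abs_mult[of d3 x] by linarith
    also have "K * x^2 \<le> K * x" using x K power_decreasing[of 1 2 x] by (intro mult_left_mono) auto
    finally show "\<bar>d2\<bar> \<le> (K + \<bar>d3\<bar>) * x" by (simp add: algebra_simps)
  qed
  have 3: "d3 = 0"
  proof (rule eq_0_if_abs_le_linear)
    fix x :: real assume x: "0 < x" "x \<le> 1"
    have "x^3 * \<bar>d3\<bar> \<le> x^3 * (K * x)"
      using assms[OF x] x 1 2 by (simp add: abs_mult algebra_simps power2_eq_square power3_eq_cube power4_eq_xxxx)
    thus "\<bar>d3\<bar> \<le> K * x" using x by simp
  qed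
  from 1 2 3 show ?thesis by simp
qed

lemma ln_one_plus_cubic_bound:
  fixes A1 A2 A3 :: real
  assumes "A1 \<ge> 0" "A2 \<ge> 0" "A3 \<ge> 0"
  obtains C where "\<And>x. 0 < x \<Longrightarrow> x \<le> 1 \<Longrightarrow>
     \<bar>ln (1 + (A1 * x + A2 * x^2 + A3 * x^3))
       - (A1 * x + (A2 - A1^2/2) * x^2 + (A3 - A1 * A2 + A1^3/3) * x^3)\<bar> \<le> C * x^4"
proof -
  \<comment> \<open>\<open>x ^ 4 * Q x\<close> collects the terms of degree at least 4 of y - y^2/2
    + y^3/3 for y = A1 x + A2 x^2 + A3 x^3. As a polynomial, \<open>Q\<close> is bounded on
    [0, 1].\<close>
  define Q where "Q x = - (2 * A1 * A3 + (A2 + A3 * x)^2) / 2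
     + (3 * A1^2 * (A2 + A3 * x) + 3 * A1 * x * (A2 + A3 * x)^2 + x^2 * (A2 + A3 * x)^3) / 3" for x
  have "compact (Q ` {0..1})"
    unfolding Q_def by (intro compact_continuous_image continuous_intros) auto
  then obtain M where M: "\<And>x. x \<in> {0..1} \<Longrightarrow> \<bar>Q x\<bar> \<le> M"
    using compact_imp_bounded bounded_real by (metis imageI)
  define s where "s = A1 + A2 + A3"
  show ?thesis
  proof (rule that)
    fix x :: real assume x: "0 < x" "x \<le> 1"
    define y where "y = A1 * x + A2 * x^2 + A3 * x^3"
    have y0: "y \<ge> 0" using assms x by (simp add: y_def)
    have "x^2 \<le> x" "x^3 \<le> x" using x power_decreasing[of 1 _ x] by auto
    hence "y \<le> A1 * x + A2 * x + A3 * x"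
      unfolding y_def using assms by (intro add_mono mult_left_mono) auto
    hence "y \<le> s * x" by (simp add: s_def algebra_simps)
    hence "y^4 \<le> (s * x)^4" using y0 by (intro power_mono) auto
    hence y4: "y^4 \<le> s^4 * x^4" by (simp add: power_mult_distrib)
    have eq: "y - y^2/2 + y^3/3 = (A1 * x + (A2 - A1^2/2) * x^2 + (A3 - A1 * A2 + A1^3/3) * x^3) + x^4 * Q x"
      unfolding y_def Q_def by (simp add: field_simps) algebra
    have "\<bar>x^4 * Q x\<bar> \<le> x^4 * M" unfolding abs_mult using M[of x] x by (intro mult_mono) auto
    hence "\<bar>x^4 * Q x\<bar> \<le> M * x^4" by (simp add: mult.commute)
    with ln_one_plus_bounds[OF y0] y4 eq
    have "\<bar>ln (1 + y) - (A1 * x + (A2 - A1^2/2) * x^2 + (A3 - A1 * A2 + A1^3/3) * x^3)\<bar>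
             \<le> M * x^4 + s^4 * x^4 / 4"
      using zero_le_power[of y 4] y0 by linarith
    thus "\<bar>ln (1 + (A1 * x + A2 * x^2 + A3 * x^3))
       - (A1 * x + (A2 - A1^2/2) * x^2 + (A3 - A1 * A2 + A1^3/3) * x^3)\<bar> \<le> (M + s^4/4) * x^4"
      by (simp add: y_def algebra_simps)
  qed
qed

lemma summable_power_nonneg:
  fixes c :: "nat \<Rightarrow> real"
  assumes "summable c" "\<And>k. c k \<ge> 0"
  shows "summable (\<lambda>k. c k ^ Suc m)"
proof (induction m)
  case (Suc m)
  obtain B where B: "\<And>k. \<bar>c k\<bar> \<le> B"
    using summable_imp_Bseq[OF assms(1)] by (auto simp: Bseq_def)
  show ?case
  proof (rule summable_comparison_test')
    show "summable (\<lambda>k. B * c k ^ Suc m)" by (intro summable_mult Suc)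
    show "norm (c k ^ Suc (Suc m)) \<le> B * c k ^ Suc m" for k
      using B[of k] assms(2)[of k] by (simp add: mult_right_mono)
  qed
qed (use assms in simp)

text \<open>These are Newton's identities. The logarithm of the product formula expresses ln f(x) -
  b x as the sum of the ln(1 + c_k x) - c_k x, which is -S2 x^2/2 + S3 x^3/3 up to O(x^4).
  Comparison with the logarithm of the cubic polynomial approximating f yields the three
  coefficients.\<close>

lemma canonical_product_power_sums:
  fixes c :: "nat \<Rightarrow> real" and f :: "real \<Rightarrow> real"
  assumes c: "\<And>k. c k \<ge> 0" "summable c"
  assumes A: "A1 \<ge> 0" "A2 \<ge> 0" "A3 \<ge> 0"
  assumes f: "\<And>x. 0 < x \<Longrightarrow> x \<le> 1 \<Longrightarrow> 1 + A1 * x + A2 * x^2 + A3 * x^3 \<le> f x"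
             "\<And>x. 0 < x \<Longrightarrow> x \<le> 1 \<Longrightarrow> f x \<le> 1 + A1 * x + A2 * x^2 + A3 * x^3 + K * x^4"
  assumes lim: "\<And>x. (\<lambda>n. \<Prod>k<n. (1 + c k * x) * exp (- (c k * x))) \<longlonglongrightarrow> f x * exp (- (b * x))"
  shows "A1 = b" and "(\<Sum>k. c k ^ 2) = A1^2 - 2 * A2"
    and "(\<Sum>k. c k ^ 3) = A1^3 - 3 * A1 * A2 + 3 * A3"
proof -
  have sm: "summable (\<lambda>k. c k ^ m)" if "m > 0" for m
    using summable_power_nonneg[OF c(2,1), of "m - 1"] that by simp
  define S where "S m = (\<Sum>k. c k ^ m)" for m
  have S: "(\<lambda>n. \<Sum>k<n. c k ^ m) \<longlonglongrightarrow> S m" if "m > 0" for m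
    unfolding S_def by (rule summable_LIMSEQ[OF sm[OF that]])
  obtain C where C: "\<And>x. 0 < x \<Longrightarrow> x \<le> 1 \<Longrightarrow>
     \<bar>ln (1 + (A1 * x + A2 * x^2 + A3 * x^3))
       - (A1 * x + (A2 - A1^2/2) * x^2 + (A3 - A1 * A2 + A1^3/3) * x^3)\<bar> \<le> C * x^4"
    using ln_one_plus_cubic_bound[OF A] by blast
  have "\<bar>(A1 - b) * x + (A2 - A1^2/2 + S 2 / 2) * x^2 + (A3 - A1 * A2 + A1^3/3 - S 3 / 3) * x^3\<bar>
          \<le> (C + K + S 4 / 4) * x^4" if x: "0 < x" "x \<le> 1" for x
  proof -
    define u where "u = 1 + (A1 * x + A2 * x^2 + A3 * x^3)"
    have u: "u \<ge> 1" using A x by (simp add: u_def)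
    have fu: "u \<le> f x" "f x \<le> u + K * x^4" using f[OF x] by (auto simp: u_def)
    \<comment> \<open>Since u \<ge> 1, passing to logarithms does not enlarge the error K
      x^4.\<close>
    have "ln (f x) - ln u = ln (f x / u)" using u fu by (simp add: ln_div)
    also have "\<dots> \<le> f x / u - 1" using u fu by (intro ln_le_minus_one) auto
    also have "\<dots> = (f x - u) / u" using u by (simp add: field_simps)
    also have "\<dots> \<le> (f x - u) / 1" using u fu by (intro divide_left_mono) auto
    finally have lnf: "ln u \<le> ln (f x)" "ln (f x) \<le> ln u + K * x^4"
      using u fu by auto
    have "(\<lambda>n. ln (\<Prod>k<n. (1 + c k * x) * exp (- (c k * x)))) \<longlonglongrightarrow> ln (f x * exp (- (b * x)))"
      using u fu by (intro tendsto_ln lim) auto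
    moreover have "ln (\<Prod>k<n. (1 + c k * x) * exp (- (c k * x))) = (\<Sum>k<n. ln (1 + c k * x) - c k * x)" for n
    proof -
      have pos: "1 + c k * x > 0" for k using c(1)[of k] x by (simp add: add_pos_nonneg)
      have "ln ((1 + c k * x) * exp (- (c k * x))) = ln (1 + c k * x) - c k * x" for k
        using pos[of k] by (subst ln_mult) auto
      moreover have "1 + c k * x \<noteq> 0" for k using pos[of k] by simp
      ultimately show ?thesis using pos by (subst ln_prod) auto
    qed
    moreover have "ln (f x * exp (- (b * x))) = ln (f x) - b * x"
      using u fu by (subst ln_mult) auto
    ultimately have L: "(\<lambda>n. \<Sum>k<n. ln (1 + c k * x) - c k * x) \<longlonglongrightarrow> ln (f x) - b * x" by simp
    have cx: "c k * x \<ge> 0" for k using c x by simp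
    have up: "ln (f x) - b * x \<le> - S 2 * x^2/2 + S 3 * x^3/3"
    proof (rule LIMSEQ_le[OF L])
      show "(\<lambda>n. - (\<Sum>k<n. c k ^ 2) * x^2/2 + (\<Sum>k<n. c k ^ 3) * x^3/3) \<longlonglongrightarrow> - S 2 * x^2/2 + S 3 * x^3/3"
        by (intro tendsto_intros S) auto
      have "(\<Sum>k<n. ln (1 + c k * x) - c k * x)
          \<le> - (\<Sum>k<n. c k ^ 2) * x^2/2 + (\<Sum>k<n. c k ^ 3) * x^3/3" for n
      proof -
        have "(\<Sum>k<n. ln (1 + c k * x) - c k * x) \<le> (\<Sum>k<n. (c k * x)^3/3 - (c k * x)^2/2)"
          by (intro sum_mono) (use ln_one_plus_bounds(1)[OF cx] in \<open>smt (verit)\<close>)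
        also have "\<dots> = - (\<Sum>k<n. c k ^ 2) * x^2/2 + (\<Sum>k<n. c k ^ 3) * x^3/3"
          by (simp add: power_mult_distrib sum_distrib_right sum_divide_distrib sum_subtractf)
        finally show ?thesis .
      qed
      thus "\<exists>N. \<forall>n\<ge>N. (\<Sum>k<n. ln (1 + c k * x) - c k * x)
          \<le> - (\<Sum>k<n. c k ^ 2) * x^2/2 + (\<Sum>k<n. c k ^ 3) * x^3/3" by blast
    qed
    have lo: "- S 2 * x^2/2 + S 3 * x^3/3 - S 4 * x^4/4 \<le> ln (f x) - b * x"
    proof (rule LIMSEQ_le[OF _ L])
      show "(\<lambda>n. - (\<Sum>k<n. c k ^ 2) * x^2/2 + (\<Sum>k<n. c k ^ 3) * x^3/3 - (\<Sum>k<n. c k ^ 4) * x^4/4)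
         \<longlonglongrightarrow> - S 2 * x^2/2 + S 3 * x^3/3 - S 4 * x^4/4"
        by (intro tendsto_intros S) auto
      have "- (\<Sum>k<n. c k ^ 2) * x^2/2 + (\<Sum>k<n. c k ^ 3) * x^3/3 - (\<Sum>k<n. c k ^ 4) * x^4/4
          \<le> (\<Sum>k<n. ln (1 + c k * x) - c k * x)" for n
      proof -
        have "- (\<Sum>k<n. c k ^ 2) * x^2/2 + (\<Sum>k<n. c k ^ 3) * x^3/3 - (\<Sum>k<n. c k ^ 4) * x^4/4
            = (\<Sum>k<n. (c k * x)^3/3 - (c k * x)^2/2 - (c k * x)^4/4)"
          by (simp add: power_mult_distrib sum_distrib_right sum_divide_distrib sum_subtractf)
        also have "\<dots> \<le> (\<Sum>k<n. ln (1 + c k * x) - c k * x)"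
          by (intro sum_mono) (use ln_one_plus_bounds(2)[OF cx] in \<open>smt (verit)\<close>)
        finally show ?thesis .
      qed
      thus "\<exists>N. \<forall>n\<ge>N. - (\<Sum>k<n. c k ^ 2) * x^2/2 + (\<Sum>k<n. c k ^ 3) * x^3/3 - (\<Sum>k<n. c k ^ 4) * x^4/4
          \<le> (\<Sum>k<n. ln (1 + c k * x) - c k * x)" by blast
    qed
    have "(A1 - b) * x + (A2 - A1^2/2 + S 2 / 2) * x^2 + (A3 - A1 * A2 + A1^3/3 - S 3 / 3) * x^3
       = (A1 * x + (A2 - A1^2/2) * x^2 + (A3 - A1 * A2 + A1^3/3) * x^3) - b * x - (- S 2 * x^2/2 + S 3 * x^3/3)"
      by (simp add: algebra_simps)
    moreover have "(C + K + S 4 / 4) * x^4 = C * x^4 + K * x^4 + S 4 * x^4/4" by (simp add: algebra_simps)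
    moreover have "S 4 * x^4 / 4 \<ge> 0" "K * x^4 \<ge> 0"
      using x fu c by (auto simp: S_def intro!: mult_nonneg_nonneg suminf_nonneg sm)
    ultimately show ?thesis
      using C[OF x] lnf up lo unfolding u_def by linarith
  qed
  hence "A1 - b = 0 \<and> A2 - A1^2/2 + S 2 / 2 = 0 \<and> A3 - A1 * A2 + A1^3/3 - S 3 / 3 = 0"
    by (rule cubic_eq_0_if_quartic_bound)
  thus "A1 = b" "(\<Sum>k. c k ^ 2) = A1^2 - 2 * A2" "(\<Sum>k. c k ^ 3) = A1^3 - 3 * A1 * A2 + 3 * A3"
    by (auto simp: S_def field_simps)
qed

section \<open>Necessity\<close>

(* The condition g \<ge> 1 on the positive axis forces \<alpha> = 0 and (\<Sum>k<n. c k) \<le> b in the limit x \<rightarrow> \<infinity>,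
   since each factor (1 + c k x) exp (- c k x) is at most 1 there. *)
lemma laguerre_polya_canonical_product:
  assumes LP: "laguerre_polya f" and fg: "\<And>x. f (of_real x) = of_real (g x)"
    and g0: "g 0 = 1" and g1: "\<And>x. x \<ge> 0 \<Longrightarrow> g x \<ge> 1"
  shows "\<exists>b c. (\<forall>k. c k \<ge> 0) \<and> (\<forall>n. (\<Sum>k<n. c k) \<le> b) \<and>
    (\<forall>x. (\<lambda>n. \<Prod>k<n. (1 + c k * x) * exp (- (c k * x))) \<longlonglongrightarrow> g x * exp (- (b * x))) \<and>
    (\<forall>k. c k > 0 \<longrightarrow> g (- (1 / c k)) = 0)"
proof -
  from LP obtain C :: real and n \<alpha> b I x where \<alpha>: "\<alpha> \<ge> 0" and x: "\<forall>k\<in>I. x k \<noteq> 0"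
    and rep: "\<forall>z. \<exists>P. (\<lambda>k. if k \<in> I
                     then (1 - z / of_real (x k)) * exp (z / of_real (x k)) else 1) has_prod P \<and>
          f z = of_real C * z ^ n * exp (- of_real \<alpha> * z\<^sup>2 + of_real b * z) * P"
    unfolding laguerre_polya_def by (elim conjE exE) (rule that)
  \<comment> \<open>Zeros are written as -1/c_k, so that negative zeros get c_k > 0; the value c_k =
    0 encodes an absent factor.\<close>
  define c where "c k = (if k \<in> I then - (1 / x k) else 0)" for k
  have factor: "(if k \<in> I then (1 - of_real y / of_real (x k)) * exp (of_real y / of_real (x k)) else 1)
      = complex_of_real ((1 + c k * y) * exp (- (c k * y)))" for y k
    by (auto simp: c_def simp flip: exp_of_real)
  have P: "\<exists>P. (\<lambda>n. \<Prod>k<n. (1 + c k * y) * exp (- (c k * y))) \<longlonglongrightarrow> P \<and> g y = C * y ^ n * exp (- \<alpha> * y\<^sup>2 + b * y) * P" for y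
  proof -
    from rep[rule_format, of "of_real y", unfolded factor]
    obtain P :: complex where "(\<lambda>k. complex_of_real ((1 + c k * y) * exp (- (c k * y)))) has_prod P \<and>
        f (of_real y) = of_real C * of_real y ^ n * exp (- of_real \<alpha> * (of_real y)\<^sup>2 + of_real b * of_real y) * P"
      by (elim exE)
    hence P: "(\<lambda>k. complex_of_real ((1 + c k * y) * exp (- (c k * y)))) has_prod P"
      and eq: "f (of_real y) = of_real C * of_real y ^ n * exp (- of_real \<alpha> * (of_real y)\<^sup>2 + of_real b * of_real y) * P"
      by blast+
    have lim: "(\<lambda>n. complex_of_real (\<Prod>k<n. (1 + c k * y) * exp (- (c k * y)))) \<longlonglongrightarrow> P"
      using has_prod_imp_tendsto'[OF P] by simp
    have "P \<in> \<real>"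
      by (rule closed_sequentially[OF closed_complex_Reals _ lim]) auto
    then obtain p where p: "P = of_real p" by (auto elim: Reals_cases)
    have "complex_of_real (g y) = of_real (C * y ^ n * exp (- \<alpha> * y\<^sup>2 + b * y) * p)"
      using eq by (simp add: fg p flip: exp_of_real)
    hence "g y = C * y ^ n * exp (- \<alpha> * y\<^sup>2 + b * y) * p" unfolding of_real_eq_iff .
    moreover have "(\<lambda>n. \<Prod>k<n. (1 + c k * y) * exp (- (c k * y))) \<longlonglongrightarrow> p"
      using lim unfolding p tendsto_of_real_iff .
    ultimately show ?thesis by blast
  qed
  have "n = 0" using P[of 0] g0 by (auto simp: power_0_left split: if_splits)
  have "C = 1"
  proof -
    obtain p where p: "(\<lambda>n. 1 :: real) \<longlonglongrightarrow> p" "1 = C * p"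
      using P[of 0] g0 \<open>n = 0\<close> by auto
    from p(1) have "p = 1" by (simp add: LIMSEQ_const_iff)
    with p show ?thesis by simp
  qed
  have lim: "(\<lambda>n. \<Prod>k<n. (1 + c k * y) * exp (- (c k * y))) \<longlonglongrightarrow> g y * exp (\<alpha> * y\<^sup>2 - b * y)" for y
    using P[of y] by (auto simp: \<open>n = 0\<close> \<open>C = 1\<close> exp_minus exp_add exp_diff)
  have zero: "g (- (1 / c k)) = 0" if "c k \<noteq> 0" for k
  proof -
    have "(\<lambda>n. \<Prod>i<n. (1 + c i * (- (1 / c k))) * exp (- (c i * (- (1 / c k))))) \<longlonglongrightarrow> 0"
    proof (rule tendsto_eventually)
      show "\<forall>\<^sub>F n in sequentially. (\<Prod>i<n. (1 + c i * (- (1 / c k))) * exp (- (c i * (- (1 / c k))))) = 0"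
        using eventually_gt_at_top[of k] by eventually_elim (use that in auto)
    qed
    with lim[of "- (1 / c k)"] have "g (- (1 / c k)) * exp (\<alpha> * (- (1 / c k))\<^sup>2 - b * (- (1 / c k))) = 0"
      using LIMSEQ_unique by blast
    thus ?thesis by simp
  qed
  have c: "c k \<ge> 0" for k
  proof (rule ccontr)
    assume "\<not> c k \<ge> 0"
    hence "g (- (1 / c k)) = 0" "- (1 / c k) \<ge> 0" using zero[of k] by auto
    thus False using g1[of "- (1 / c k)"] by simp
  qed
  \<comment> \<open>For y \<ge> 0 the partial products decrease to their limit, so each of them
    bounds g(y) from above once multiplied by the exponential factor.\<close>
  have upper: "g y \<le> exp (- \<alpha> * y\<^sup>2 + b * y) * (\<Prod>k<m. (1 + c k * y) * exp (- (c k * y)))" if y: "y \<ge> 0" for y m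
  proof -
    have "decseq (\<lambda>n. \<Prod>k<n. (1 + c k * y) * exp (- (c k * y)))"
    proof (rule decseq_SucI)
      fix n
      have cy: "c k * y \<ge> 0" for k using c y by simp
      have "(1 + c n * y) * exp (- (c n * y)) \<le> 1"
        using exp_ge_add_one_self[of "c n * y"] by (simp add: exp_minus field_simps)
      thus "(\<Prod>k<Suc n. (1 + c k * y) * exp (- (c k * y))) \<le> (\<Prod>k<n. (1 + c k * y) * exp (- (c k * y)))"
        using cy by (auto intro!: mult_left_le prod_nonneg)
    qed
    from decseq_ge[OF this lim, of m] show ?thesis
      by (simp add: exp_diff exp_add exp_minus field_simps)
  qed
  have "\<alpha> = 0"
  proof (rule ccontr)
    assume "\<alpha> \<noteq> 0"
    with \<alpha> have a: "\<alpha> > 0" by simp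
    \<comment> \<open>With this choice \<alpha> y = |b| + 1 exceeds b, whereas the upper bound with
      the empty product forces \<alpha> y \<le> b.\<close>
    define y where "y = (\<bar>b\<bar> + 1) / \<alpha>"
    have y: "y > 0" using a by (simp add: y_def)
    have "1 \<le> exp (- \<alpha> * y\<^sup>2 + b * y)" using order.trans[OF g1[of y] upper[of y 0]] y by simp
    hence "0 \<le> y * (b - \<alpha> * y)" by (simp add: algebra_simps power2_eq_square)
    hence "\<alpha> * y \<le> b" using y by (simp add: zero_le_mult_iff)
    thus False using a by (simp add: y_def)
  qed
  have sum: "(\<Sum>k<m. c k) \<le> b" for m
  proof -
    have "0 \<le> (b - (\<Sum>k<m. c k)) + (\<Sum>k<m. ln (1 + c k * y) / y)" if y: "y > 0" for y
    proof -
      have pos: "1 + c k * y > 0" for k using c[of k] y by (simp add: add_pos_nonneg)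
      have ne: "1 + c k * y \<noteq> 0" for k using pos[of k] by simp
      have "1 \<le> exp (b * y) * (\<Prod>k<m. (1 + c k * y) * exp (- (c k * y)))"
        using upper[of y m] g1[of y] y by (simp add: \<open>\<alpha> = 0\<close>)
      hence "ln 1 \<le> ln (exp (b * y) * (\<Prod>k<m. (1 + c k * y) * exp (- (c k * y))))"
        using pos by (subst ln_le_cancel_iff) (auto intro!: mult_pos_pos prod_pos)
      also have "\<dots> = b * y + ln (\<Prod>k<m. (1 + c k * y) * exp (- (c k * y)))"
        using ne by (subst ln_mult) auto
      also have "ln (\<Prod>k<m. (1 + c k * y) * exp (- (c k * y))) = (\<Sum>k<m. ln ((1 + c k * y) * exp (- (c k * y))))"
        using pos ne by (subst ln_prod) auto
      also have "\<dots> = (\<Sum>k<m. ln (1 + c k * y) - c k * y)"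
        using ne by (intro sum.cong refl) (subst ln_mult, auto)
      finally have "0 \<le> (b * y + (\<Sum>k<m. ln (1 + c k * y) - c k * y)) / y" using y by simp
      also have "\<dots> = (b - (\<Sum>k<m. c k)) + (\<Sum>k<m. ln (1 + c k * y) / y)"
        using y by (simp add: field_simps sum_subtractf sum_distrib_left flip: sum_divide_distrib)
      finally show ?thesis .
    qed
    hence ev: "eventually (\<lambda>y. 0 \<le> (b - (\<Sum>k<m. c k)) + (\<Sum>k<m. ln (1 + c k * y) / y)) at_top"
      using eventually_gt_at_top[of 0] by (rule eventually_mono[rotated])
    have "((\<lambda>y. ln (1 + d * y) / y) \<longlongrightarrow> 0) at_top" if "d \<ge> 0" for d :: real
      using that by (cases "d = 0") (simp, real_asymp)
    hence "((\<lambda>y. (b - (\<Sum>k<m. c k)) + (\<Sum>k<m. ln (1 + c k * y) / y)) \<longlongrightarrow> (b - (\<Sum>k<m. c k)) + (\<Sum>k<m. 0)) at_top"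
      using c by (intro tendsto_intros) auto
    from tendsto_lowerbound[OF this ev] show ?thesis by simp
  qed
  show ?thesis
    by (intro exI[of _ b] exI[of _ c]) (use c sum lim zero in \<open>auto simp: \<open>\<alpha> = 0\<close>\<close>)
qed

lemma laguerre_polya_F_imp:
  assumes a: "a > 1" and LP: "laguerre_polya (F a)"
  shows "\<exists>x\<in>{a + 1<..<a ^ 2 + 1}. Freal a (- x) \<le> 0"
proof (rule ccontr)
  assume "\<not> ?thesis"
  hence pos: "Freal a (- x) > 0" if "0 \<le> x" "x < a ^ 2 + 1" for x
  proof (cases "x \<le> a + 1")
    case False
    with that have "x \<in> {a + 1<..<a ^ 2 + 1}" by simp
    with \<open>\<not> (\<exists>x\<in>_. _)\<close> show ?thesis by (meson not_le)
  qed (use that Freal_minus_pos[OF a] in simp)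
  define p q r where "p = a + 1" and "q = a ^ 2 + 1" and "r = a ^ 3 + 1"
  have pqr: "p > 0" "q > 0" "r > 0"
    using a power_add_one_pos[OF a] by (auto simp: p_def q_def r_def)
  have "\<exists>b c. (\<forall>k. c k \<ge> 0) \<and> (\<forall>n. (\<Sum>k<n. c k) \<le> b) \<and>
    (\<forall>x. (\<lambda>n. \<Prod>k<n. (1 + c k * x) * exp (- (c k * x))) \<longlonglongrightarrow> Freal a x * exp (- (b * x))) \<and>
    (\<forall>k. c k > 0 \<longrightarrow> Freal a (- (1 / c k)) = 0)"
    by (rule laguerre_polya_canonical_product[OF LP F_of_real[OF a] Freal_0[OF a]]) (rule Freal_ge_1[OF a])
  then obtain b c where H: "(\<forall>k. c k \<ge> 0) \<and> (\<forall>n. (\<Sum>k<n. c k) \<le> b) \<and>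
    (\<forall>x. (\<lambda>n. \<Prod>k<n. (1 + c k * x) * exp (- (c k * x))) \<longlonglongrightarrow> Freal a x * exp (- (b * x))) \<and>
    (\<forall>k. c k > 0 \<longrightarrow> Freal a (- (1 / c k)) = 0)"
    by (elim exE)
  hence c: "c k \<ge> 0" "(\<Sum>k<n. c k) \<le> b"
    and lim: "(\<lambda>n. \<Prod>k<n. (1 + c k * x) * exp (- (c k * x))) \<longlonglongrightarrow> Freal a x * exp (- (b * x))"
    and zero: "c k > 0 \<Longrightarrow> Freal a (- (1 / c k)) = 0" for n k x
    by simp_all
  \<comment> \<open>A positive c_k gives the zero -1/c_k, and there is no zero in (-q, 0].\<close>
  have cq: "c k \<le> 1 / q" for k
  proof (rule ccontr)
    assume *: "\<not> c k \<le> 1 / q"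
    hence "c k > 0" using pqr by (meson divide_pos_pos less_trans not_le zero_less_one)
    moreover from this have "1 / c k < q" using * pqr by (simp add: field_simps)
    ultimately show False using zero[of k] pos[of "1 / c k"] by (simp add: q_def)
  qed
  have smc: "summable c" using c by (intro summableI_nonneg_bounded) auto
  have sm: "summable (\<lambda>k. c k ^ m)" if "m > 0" for m
    using summable_power_nonneg[OF smc c(1), of "m - 1"] that by simp
  have Fd: "Fden a 1 = p" "Fden a 2 = p * q" "Fden a 3 = p * q * r"
    by (simp_all add: p_def q_def r_def eval_nat_numeral Fden_Suc mult_ac)
  have part: "(\<Sum>k<4. x ^ k / Fden a k) = 1 + 1 / p * x + 1 / (p * q) * x^2 + 1 / (p * q * r) * x^3" for x
    using Fd by (simp add: eval_nat_numeral)
  have lo: "1 + 1 / p * x + 1 / (p * q) * x^2 + 1 / (p * q * r) * x^3 \<le> Freal a x" if "0 < x" "x \<le> 1" for x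
    using Freal_ge_partial[OF a, of x 4] that unfolding part by simp
  \<comment> \<open>For x \<le> 1 each x^(k+4) is at most x^4, so the value of the tail at x = 1
    serves as the constant of the quartic error.\<close>
  have up: "Freal a x \<le> 1 + 1 / p * x + 1 / (p * q) * x^2 + 1 / (p * q * r) * x^3
      + (\<Sum>k. 1 / Fden a (k + 4)) * x^4" if "0 < x" "x \<le> 1" for x
  proof -
    have "Freal a x - (\<Sum>k<4. x ^ k / Fden a k) = (\<Sum>k. x ^ (k + 4) / Fden a (k + 4))"
      unfolding Freal_def by (rule suminf_minus_initial_segment[OF Freal_summable[OF a], symmetric])
    also have "\<dots> \<le> (\<Sum>k. 1 / Fden a (k + 4) * x^4)"
    proof (rule suminf_le)
      show "summable (\<lambda>k. x ^ (k + 4) / Fden a (k + 4))"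
        using summable_ignore_initial_segment[OF Freal_summable[OF a]] .
      show "summable (\<lambda>k. 1 / Fden a (k + 4) * x^4)"
        using summable_ignore_initial_segment[OF Freal_summable[OF a, of 1], of 4]
        by (intro summable_mult2) simp
      show "x ^ (k + 4) / Fden a (k + 4) \<le> 1 / Fden a (k + 4) * x^4" for k
        using Fden_pos[OF a, of "k + 4"] that by (simp add: divide_right_mono power_decreasing)
    qed
    also have "\<dots> = (\<Sum>k. 1 / Fden a (k + 4)) * x^4"
      using summable_ignore_initial_segment[OF Freal_summable[OF a, of 1], of 4]
      by (intro suminf_mult2[symmetric]) simp
    finally show ?thesis unfolding part by simp
  qed
  have A: "1 / p \<ge> 0" "1 / (p * q) \<ge> 0" "1 / (p * q * r) \<ge> 0" using pqr by auto
  note sums = canonical_product_power_sums[OF c(1) smc A lo up lim]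
  define S2 S3 where "S2 = (\<Sum>k. c k ^ 2)" and "S3 = (\<Sum>k. c k ^ 3)"
  have b: "b = 1 / p" using sums(1) by simp
  have S2: "S2 = (q - 2 * p) / (p^2 * q)"
    using sums(2) pqr unfolding S2_def by (simp add: field_simps power2_eq_square)
  have S3: "S3 = (q * r - 3 * p * r + 3 * p^2) / (p^3 * q * r)"
    using sums(3) pqr unfolding S3_def by (simp add: field_simps power2_eq_square power3_eq_cube)
  have S1: "suminf c \<le> 1 / p"
    using c(2) b suminf_le_const[OF smc] by simp
  have "S3 \<le> (\<Sum>k. 1 / q * c k ^ 2)"
    unfolding S3_def
  proof (rule suminf_le)
    show "c k ^ 3 \<le> 1 / q * c k ^ 2" for k
      using mult_right_mono[OF cq[of k], of "c k ^ 2"] by (simp add: power3_eq_cube power2_eq_square)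
  qed (auto intro!: sm summable_mult)
  also have "\<dots> = S2 / q" unfolding S2_def by (subst suminf_mult) (auto intro: sm)
  finally have "S3 * (p^3 * q^2 * r) \<le> S2 / q * (p^3 * q^2 * r)"
    using pqr by (intro mult_right_mono) auto
  hence 1: "q * (q * r - 3 * p * r + 3 * p^2) \<le> p * r * (q - 2 * p)"
    using pqr by (simp add: S2 S3 power2_eq_square power3_eq_cube mult_ac)
  \<comment> \<open>The expansion S3 - 2 l S2 + l^2 S1, bounded above through S1 \<le> 1/p, is
    smallest at l = p S2. This is the Cauchy-Schwarz inequality in the form p S2^2 \<le> S3.\<close>
  define l where "l = S2 * p"
  have "0 \<le> (\<Sum>k. c k * (c k - l)^2)"
  proof (rule suminf_nonneg)
    have "summable (\<lambda>k. c k ^ 3 - 2 * l * c k ^ 2 + l^2 * c k)"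
      by (intro summable_add summable_diff summable_mult sm smc) auto
    thus "summable (\<lambda>k. c k * (c k - l)^2)"
      by (simp add: power2_eq_square power3_eq_cube algebra_simps)
  qed (use c in auto)
  also have "(\<lambda>k. c k * (c k - l)^2) = (\<lambda>k. c k ^ 3 - 2 * l * c k ^ 2 + l^2 * c k)"
    by (simp add: power2_eq_square power3_eq_cube algebra_simps)
  also have "suminf \<dots> = S3 - 2 * l * S2 + l^2 * suminf c"
    unfolding S2_def S3_def
    by (simp add: suminf_add[symmetric] suminf_diff[symmetric] suminf_mult summable_add summable_diff summable_mult sm smc)
  also have "\<dots> \<le> S3 - 2 * l * S2 + l^2 * (1 / p)"
    using S1 by (intro add_left_mono mult_left_mono) auto
  also have "\<dots> = S3 - S2^2 * p" using pqr by (simp add: l_def power2_eq_square field_simps)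
  finally have "S2^2 * p * (p^3 * q^2 * r) \<le> S3 * (p^3 * q^2 * r)"
    using pqr by (intro mult_right_mono) auto
  hence 2: "(q - 2 * p)^2 * r \<le> q * (q * r - 3 * p * r + 3 * p^2)"
    using pqr by (simp add: S2 S3 power2_eq_square power3_eq_cube mult_ac)
  \<comment> \<open>Eliminating the expression shared by \<open>1\<close> and \<open>2\<close>
    leaves r (q - 2p)^2 \<le> p r (q - 2p).\<close>
  have "r * ((q - 2 * p) * (q - 3 * p)) \<le> 0"
    using 1 2 by (simp add: algebra_simps power2_eq_square)
  hence q3: "q \<le> 3 * p"
    using pqr by (auto simp: mult_le_0_iff)
  \<comment> \<open>This says q/p < r/q. Inserted into \<open>3\<close>, a rearrangement of
    \<open>2\<close>, with 4p - q positive by q \<le> 3p, it leads to q > 3p and so to a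
    contradiction.\<close>
  have "r * p - q^2 = a * (a - 1)^2" unfolding p_def q_def r_def by algebra
  moreover have "a * (a - 1)^2 > 0" using a by simp
  ultimately have rpq: "q^2 < r * p" by simp
  have "a * 1 < a * a" using a by (intro mult_strict_left_mono) auto
  hence qp: "q > p" by (simp add: p_def q_def power2_eq_square)
  have "p * (r * (4 * p - q)) \<le> p * (3 * p * q)"
    using 2 by (simp add: algebra_simps power2_eq_square)
  hence 3: "p * (r * (4 * p - q)) \<le> 3 * p^2 * q" by (simp add: power2_eq_square mult_ac)
  have "q^2 * (4 * p - q) < (r * p) * (4 * p - q)"
    using rpq q3 pqr by (intro mult_strict_right_mono) auto
  hence "q * (q * (4 * p - q)) < q * (3 * p^2)" using 3 by (simp add: power2_eq_square mult_ac)
  hence "q * (4 * p - q) < 3 * p^2" using pqr by simp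
  hence "0 < (q - p) * (q - 3 * p)" by (simp add: algebra_simps power2_eq_square)
  thus False using qp q3 by (auto simp: zero_less_mult_iff)
qed

section \<open>Sufficiency\<close>

lemma entire_factor_zeros:
  fixes f :: "complex \<Rightarrow> complex"
  assumes "finite S" "f holomorphic_on UNIV" "\<And>s. s \<in> S \<Longrightarrow> s \<noteq> 0 \<and> f s = 0"
  shows "\<exists>h. h holomorphic_on UNIV \<and> (\<forall>z. f z = (\<Prod>s\<in>S. (1 - z / s)) * h z)"
  using assms(1,3)
proof (induction S)
  case empty
  show ?case using assms(2) by auto
next
  case (insert s S)
  then obtain h where h: "h holomorphic_on UNIV" and fh: "\<And>z. f z = (\<Prod>s\<in>S. (1 - z / s)) * h z"
    by auto
  have s: "s \<noteq> 0" using insert.prems by auto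
  \<comment> \<open>As the points are distinct, the factors already split off do not vanish at s, so
    the quotient h must.\<close>
  have "(\<Prod>r\<in>S. (1 - s / r)) \<noteq> 0"
    using insert.hyps insert.prems by (auto simp: prod_zero_iff)
  hence "h s = 0" using fh[of s] insert.prems by auto
  \<comment> \<open>The difference quotient, completed by the derivative at the removable
    singularity s; the factor -s accounts for dividing by 1 - z/s instead of z - s.\<close>
  define h2 where "h2 z = - s * (if z = s then deriv h s else (h z - h s) / (z - s))" for z
  have "h2 holomorphic_on UNIV"
    unfolding h2_def by (intro holomorphic_intros pole_lemma_open h) auto
  moreover have "h z = (1 - z / s) * h2 z" for z
    using s \<open>h s = 0\<close> by (auto simp: h2_def field_simps)
  hence "f z = (\<Prod>s\<in>insert s S. (1 - z / s)) * h2 z" for z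
    using insert.hyps by (simp add: fh[of z] mult_ac)
  ultimately show ?case by blast
qed

lemma entire_factor_zero_seq:
  fixes f :: "complex \<Rightarrow> complex" and t :: "nat \<Rightarrow> real"
  assumes "finite A" "f holomorphic_on UNIV" "inj_on t A" "\<And>k. k \<in> A \<Longrightarrow> t k \<noteq> 0 \<and> f (of_real (t k)) = 0"
  shows "\<exists>h. h holomorphic_on UNIV \<and> (\<forall>z. f z = (\<Prod>k\<in>A. (1 - z / of_real (t k))) * h z)"
proof -
  have "inj_on (\<lambda>k. complex_of_real (t k)) A"
    using assms(3) by (auto simp: inj_on_def)
  hence "(\<Prod>s\<in>(\<lambda>k. of_real (t k)) ` A. (1 - z / s)) = (\<Prod>k\<in>A. (1 - z / of_real (t k)))" for z :: complex
    by (subst prod.reindex) auto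
  moreover have "\<exists>h. h holomorphic_on UNIV \<and>
      (\<forall>z. f z = (\<Prod>s\<in>(\<lambda>k. of_real (t k)) ` A. (1 - z / s)) * h z)"
    by (rule entire_factor_zeros) (use assms in auto)
  ultimately show ?thesis by simp
qed

text \<open>Cauchy's inequality bounds the n-th Taylor coefficient by M / R^n. For |z| \<le> R/2 the
  terms of degree at least 2 are dominated by a geometric series of ratio 1/2, whose sum accounts
  for the factor 2.\<close>

lemma Cauchy_linear_approx:
  fixes h :: "complex \<Rightarrow> complex"
  assumes h: "h holomorphic_on UNIV" and R: "R > 0"
    and M: "\<And>z. norm z = R \<Longrightarrow> norm (h z) \<le> M" and z: "norm z \<le> R / 2"
  shows "norm (h z - h 0 - deriv h 0 * z) \<le> 2 * M * (norm z / R)^2"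
proof -
  define c where "c n = (deriv ^^ n) h 0 / fact n" for n
  define r where "r = norm z / R"
  have r: "0 \<le> r" "r \<le> 1 / 2" using z R by (auto simp: r_def field_simps)
  have "norm (h (of_real R)) \<le> M" using R by (intro M) auto
  hence M0: "M \<ge> 0" using norm_ge_zero order_trans by blast
  have sums: "(\<lambda>n. c n * z ^ n) sums h z"
    using holomorphic_power_series[of h 0 "norm z + 1" z] h holomorphic_on_subset[OF h]
    by (auto simp: c_def)
  have cn: "norm (c n) \<le> M / R ^ n" for n
  proof -
    have "norm ((deriv ^^ n) h 0) \<le> fact n * M / R ^ n"
      using h R M by (intro Cauchy_inequality holomorphic_on_imp_continuous_on holomorphic_on_subset[OF h]) auto
    thus ?thesis by (simp add: c_def norm_divide field_simps)
  qed
  have tail: "(\<lambda>n. c (n + 2) * z ^ (n + 2)) sums (h z - (\<Sum>n<2. c n * z ^ n))"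
    by (rule sums_split_initial_segment[OF sums])
  have bound: "norm (c (n + 2) * z ^ (n + 2)) \<le> M * r^2 * (1/2) ^ n" for n
  proof -
    have "norm (c (n + 2) * z ^ (n + 2)) \<le> M / R ^ (n + 2) * norm z ^ (n + 2)"
      unfolding norm_mult norm_power by (intro mult_right_mono cn) auto
    also have "\<dots> = M * (r^2 * r^n)" by (simp add: r_def power_divide power_add power2_eq_square)
    also have "\<dots> \<le> M * (r^2 * (1/2)^n)"
      using M0 r by (intro mult_left_mono power_mono) auto
    finally show ?thesis by (simp add: mult_ac)
  qed
  have g: "(\<lambda>n. M * r^2 * (1/2)^n) sums (M * r^2 * 2)"
    using geometric_sums[of "1/2 :: real"] by (intro sums_mult) auto
  have "norm (\<Sum>n. c (n + 2) * z ^ (n + 2)) \<le> (\<Sum>n. M * r^2 * (1/2)^n)"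
    using bound sums_summable[OF g] by (intro norm_suminf_le)
  also have "(\<Sum>n. c (n + 2) * z ^ (n + 2)) = h z - (\<Sum>n<2. c n * z ^ n)"
    using tail by (rule sums_unique[symmetric])
  also have "(\<Sum>n<2. c n * z ^ n) = h 0 + deriv h 0 * z"
    by (simp add: c_def numeral_2_eq_2)
  finally show ?thesis
    using sums_unique[OF g] by (simp add: r_def algebra_simps)
qed

text \<open>Since the sum T of the 1/t_k converges, the exponentials that the canonical form
  attaches to the factors multiply to exp((b - T) z), and the choice \<beta> = T - b cancels
  them.\<close>

lemma laguerre_polya_if_product:
  fixes t :: "nat \<Rightarrow> real" and b :: real
  assumes f: "real_entire f" and t: "\<And>k. t k > 0" "summable (\<lambda>k. 1 / t k)"
    and lim: "\<And>z. (\<lambda>n. (1 - of_real b * z) * (\<Prod>k<n. (1 + z / of_real (t k)))) \<longlonglongrightarrow> f z"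
  shows "laguerre_polya f"
proof -
  \<comment> \<open>Index 0 carries the root of 1 - bz. For b = 0 the convention 1 / 0 = 0 makes
    \<open>x 0 = 0\<close>, which drops the index from \<open>I\<close> and leaves the factor
    1.\<close>
  define x where "x k = (case k of 0 \<Rightarrow> 1 / b | Suc j \<Rightarrow> - t j)" for k
  define I where "I = {k. x k \<noteq> 0}"
  define T where "T = (\<Sum>k. 1 / t k)"
  define e :: "complex \<Rightarrow> nat \<Rightarrow> complex" where
    "e z k = (if k \<in> I then (1 - z / of_real (x k)) * exp (z / of_real (x k)) else 1)" for z k
  have e0: "e z 0 = (1 - of_real b * z) * exp (of_real b * z)" for z
    by (auto simp: e_def I_def x_def field_simps)
  have eS: "e z (Suc k) = (1 + z / of_real (t k)) * exp (- z / of_real (t k))" for z k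
    using t(1)[of k] by (auto simp: e_def I_def x_def)
  have t0: "(\<lambda>k. 1 / t k) \<longlonglongrightarrow> 0" by (rule summable_LIMSEQ_zero[OF t(2)])
  have conv: "convergent_prod (e z)" for z
  proof (rule abs_convergent_prod_imp_convergent_prod, rule summable_imp_abs_convergent_prod)
    have "(\<lambda>k. norm z * (1 / t k)) \<longlonglongrightarrow> norm z * 0" by (intro tendsto_intros t0)
    \<comment> \<open>For |w| < 1/2 the quadratic bound on the Weierstrass factor is at most a
      multiple of |w|, so convergence of the sum of the 1/t_k suffices.\<close>
    hence "eventually (\<lambda>k. norm z * (1 / t k) < 1 / 2) sequentially"
      by (rule order_tendstoD) simp
    hence "eventually (\<lambda>k. norm (e z (Suc k) - 1) \<le> 2 * norm z * (1 / t k)) sequentially"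
    proof eventually_elim
      case (elim k)
      define w where "w = - z / of_real (t k)"
      have w: "norm w = norm z * (1 / t k)" using t(1)[of k] by (simp add: w_def norm_divide)
      have "norm (weierstrass_factor 1 w - 1) \<le> 3 * norm w ^ Suc 1"
        using elim w by (intro weierstrass_factor_bound) simp
      also have "weierstrass_factor 1 w = e z (Suc k)"
        by (simp add: weierstrass_factor_def eS w_def)
      also have "3 * norm w ^ Suc 1 = 3 * norm w * norm w" by simp
      also have "\<dots> \<le> 3 * norm w * (1 / 2)" using elim w t(1)[of k] by (intro mult_left_mono) auto
      also have "\<dots> \<le> 2 * norm w" by simp
      finally show ?case using w by simp
    qed
    hence "summable (\<lambda>k. norm (e z (Suc k) - 1))"
      by (intro summable_comparison_test_ev[OF _ summable_mult[OF t(2)]]) simp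
    thus "summable (\<lambda>k. norm (e z k - 1))" by (subst (asm) summable_Suc_iff)
  qed
  have prod: "e z has_prod (f z * exp (of_real (b - T) * z))" for z
  proof (rule convergent_prod_tendsto_imp_has_prod[OF conv])
    have "(\<lambda>n. \<Sum>k<n. 1 / t k) \<longlonglongrightarrow> T" unfolding T_def by (rule summable_LIMSEQ[OF t(2)])
    hence "(\<lambda>n. ((1 - of_real b * z) * (\<Prod>k<n. (1 + z / of_real (t k)))) * exp (of_real (b - (\<Sum>k<n. 1 / t k)) * z))
      \<longlonglongrightarrow> f z * exp (of_real (b - T) * z)"
      by (intro tendsto_intros lim)
    also have "(\<lambda>n. ((1 - of_real b * z) * (\<Prod>k<n. (1 + z / of_real (t k)))) * exp (of_real (b - (\<Sum>k<n. 1 / t k)) * z))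
       = (\<lambda>n. \<Prod>k\<le>n. e z k)"
    proof
      fix n
      have "(\<Prod>k\<le>n. e z k) = e z 0 * (\<Prod>k<n. e z (Suc k))"
        by (metis lessThan_Suc_atMost prod.lessThan_Suc_shift)
      also have "(\<Prod>k<n. e z (Suc k)) = (\<Prod>k<n. (1 + z / of_real (t k))) * exp (\<Sum>k<n. - z / of_real (t k))"
        by (simp add: eS prod.distrib exp_sum)
      also have "(\<Sum>k<n. - z / complex_of_real (t k)) = - of_real (\<Sum>k<n. 1 / t k) * z"
        by (simp add: sum_distrib_right sum_negf)
      finally show "((1 - of_real b * z) * (\<Prod>k<n. (1 + z / of_real (t k)))) * exp (of_real (b - (\<Sum>k<n. 1 / t k)) * z)
         = (\<Prod>k\<le>n. e z k)"
        by (simp add: e0 algebra_simps exp_diff exp_minus field_simps)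
    qed
    finally show "(\<lambda>n. \<Prod>k\<le>n. e z k) \<longlonglongrightarrow> f z * exp (of_real (b - T) * z)" .
  qed
  have "summable (\<lambda>k. (1 / t k) ^ Suc 1)"
    by (rule summable_power_nonneg[OF t(2)]) (use t(1) less_imp_le in auto)
  hence "summable (\<lambda>k. 1 / (x (Suc k))\<^sup>2)"
    by (simp add: x_def power2_eq_square)
  hence "summable (\<lambda>k. 1 / (x k)\<^sup>2)" by (subst (asm) summable_Suc_iff)
  hence "(\<lambda>k. 1 / (x k)\<^sup>2) summable_on UNIV"
    by (subst summable_on_UNIV_nonneg_real_iff) auto
  hence sm: "(\<lambda>k. 1 / (x k)\<^sup>2) summable_on I"
    by (rule summable_on_subset_banach) auto
  have "\<exists>P. (\<lambda>k. if k \<in> I then (1 - z / of_real (x k)) * exp (z / of_real (x k)) else 1) has_prod P \<and>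
          f z = of_real 1 * z ^ 0 * exp (- of_real 0 * z\<^sup>2 + of_real (T - b) * z) * P" for z
    using prod[of z] unfolding e_def
    by (intro exI[of _ "f z * exp (of_real (b - T) * z)"] conjI)
       (auto simp: algebra_simps exp_diff exp_minus field_simps)
  thus ?thesis
    unfolding laguerre_polya_def using f sm
    by (intro conjI exI[of _ "1::real"] exI[of _ "0::nat"] exI[of _ "0::real"] exI[of _ "T - b"] exI[of _ I] exI[of _ x])
       (auto simp: I_def)
qed

section \<open>Sign changes and zeros on the negative axis\<close>

context
  fixes a :: real
  assumes a: "a > 1"
begin

lemma F_holomorphic: "F a holomorphic_on UNIV"
  using F_real_entire[OF a] by (simp add: real_entire_def)

lemma continuous_on_Freal: "continuous_on A (Freal a)"
proof -
  have "continuous_on A (\<lambda>x. F a (of_real x))"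
    by (intro continuous_on_compose2[OF holomorphic_on_imp_continuous_on[OF F_holomorphic]]
          continuous_intros) auto
  hence "continuous_on A (\<lambda>x. Re (F a (of_real x)))" by (intro continuous_intros)
  thus ?thesis by (simp add: F_of_real[OF a])
qed

text \<open>Differentiating the functional equation at 0 gives a F'(0) = F(0) - F'(0), where F(0) =
  1.\<close>

lemma F_has_derivative_0: "(F a has_field_derivative of_real (1 / (a + 1))) (at 0)"
proof -
  define D where "D = deriv (F a) 0"
  have D: "(F a has_field_derivative D) (at 0)"
    unfolding D_def using F_holomorphic by (rule holomorphic_derivI) auto
  have F0: "F a 0 = 1" using F_of_real[OF a, of 0] Freal_0[OF a] by simp
  have "((\<lambda>z. F a (of_real a * z)) has_field_derivative D * of_real a) (at 0)"
    by (rule DERIV_chain2[of "F a" _ "\<lambda>z. of_real a * z"]) (use D in \<open>auto intro!: derivative_eq_intros\<close>)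
  moreover have "((\<lambda>z. 2 + (z - 1) * F a z) has_field_derivative (1 - D)) (at 0)"
    by (auto intro!: derivative_eq_intros D simp: F0)
  ultimately have "D * of_real a = 1 - D"
    unfolding F_functional[OF a] by (rule DERIV_unique)
  hence "D * of_real (a + 1) = 1" by (simp add: algebra_simps)
  moreover have "complex_of_real (a + 1) \<noteq> 0" using a unfolding of_real_eq_0_iff by simp
  ultimately have "D = of_real (1 / (a + 1))" by (simp add: eq_divide_eq del: of_real_add)
  with D show ?thesis by simp
qed

text \<open>The functional equation reads F(-aX) = 2 - (X + 1) F(-X). For X = x gives F(-ax) \<ge>
  2. If X \<ge> 1 and |F(-X)| \<ge> 2, then (X + 1) |F(-X)| \<ge> 4, so the sign flips and the bound
  2 reproduces itself.\<close>

lemma Freal_minus_alternating: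
  assumes x: "x \<ge> 1" "Freal a (- x) \<le> 0"
  shows "(-1) ^ k * Freal a (- (x * a ^ Suc k)) \<ge> 2"
proof (induction k)
  case 0
  have "(- x - 1) * Freal a (- x) \<ge> 0" using x by (intro mult_nonpos_nonpos) auto
  thus ?case using Freal_functional[OF a, of "- x"] by (simp add: mult.commute)
next
  case (Suc k)
  define X where "X = x * a ^ Suc k"
  have "x * a ^ Suc k \<ge> 1 * 1" using x a by (intro mult_mono one_le_power) auto
  hence X: "X \<ge> 1" by (simp add: X_def)
  define G where "G = (-1) ^ k * Freal a (- X)"
  have "G \<ge> 2" using Suc.IH by (simp add: G_def X_def)
  hence "X * G \<ge> 1 * 2" using X by (intro mult_mono) auto
  have *: "Freal a (- (x * a ^ Suc (Suc k))) = 2 + (- X - 1) * Freal a (- X)"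
    using Freal_functional[OF a, of "- X"] by (simp add: X_def mult_ac)
  have "(-1) ^ Suc k * Freal a (- (x * a ^ Suc (Suc k))) = - 2 * (-1) ^ k + (X + 1) * G"
    unfolding * G_def by (simp add: algebra_simps)
  moreover have "(-1 :: real) ^ k \<le> 1" by (cases "even k") auto
  ultimately show ?case using \<open>G \<ge> 2\<close> \<open>X * G \<ge> 1 * 2\<close> by (simp add: algebra_simps)
qed

lemma Freal_minus_zero_between:
  assumes "u < v" "Freal a (- u) * Freal a (- v) < 0"
  shows "\<exists>t. u < t \<and> t < v \<and> Freal a (- t) = 0"
proof -
  have cont: "continuous_on {u..v} (\<lambda>x. Freal a (- x))"
    by (intro continuous_on_compose2[OF continuous_on_Freal[of UNIV]] continuous_intros) auto
  have "\<exists>t. u \<le> t \<and> t \<le> v \<and> Freal a (- t) = 0"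
  proof (cases "Freal a (- u) < 0")
    case True
    with assms have "Freal a (- v) > 0" by (auto simp: mult_less_0_iff)
    thus ?thesis using True assms by (intro IVT' cont) auto
  next
    case False
    with assms have "Freal a (- u) > 0" "Freal a (- v) < 0" by (auto simp: mult_less_0_iff)
    thus ?thesis using assms by (intro IVT2' cont) auto
  qed
  then obtain t where t: "u \<le> t" "t \<le> v" "Freal a (- t) = 0" by blast
  moreover have "t \<noteq> u" "t \<noteq> v" using t assms by auto
  ultimately show ?thesis by (intro exI[of _ t]) auto
qed

lemma Freal_minus_zero_in_gap:
  assumes x: "x \<ge> 1" "Freal a (- x) \<le> 0"
  shows "\<exists>t. x * a ^ Suc k < t \<and> t < x * a ^ Suc (Suc k) \<and> Freal a (- t) = 0"
proof (rule Freal_minus_zero_between)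
  show "x * a ^ Suc k < x * a ^ Suc (Suc k)"
    using x a by (intro mult_strict_left_mono power_strict_increasing) auto
  have "((-1) ^ k * Freal a (- (x * a ^ Suc k))) * ((-1) ^ Suc k * Freal a (- (x * a ^ Suc (Suc k)))) > 0"
    using less_le_trans[OF zero_less_numeral Freal_minus_alternating[OF x, of k]]
      less_le_trans[OF zero_less_numeral Freal_minus_alternating[OF x, of "Suc k"]]
    by (rule mult_pos_pos)
  thus "Freal a (- (x * a ^ Suc k)) * Freal a (- (x * a ^ Suc (Suc k))) < 0"
    by (cases "even k") auto
qed

lemma F_minus_of_real: "F a (- of_real y) = of_real (Freal a (- y))"
  using F_of_real[OF a, of "- y"] by simp

lemma F_minus_holomorphic: "(\<lambda>z. F a (- z)) holomorphic_on UNIV"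
  using holomorphic_on_compose_gen[of "\<lambda>z. - z" UNIV "F a" UNIV] F_holomorphic
    holomorphic_on_minus[OF holomorphic_on_ident, of UNIV]
  by (simp add: o_def)

text \<open>A strictly negative value at x makes F(-y) change sign between consecutive points of
  x/a, x, xa, xa^2, and so on. Each t_k is taken from the gap between x a^(k-1) and x a^k;
  disjointness of the gaps makes the zeros distinct.\<close>

lemma F_minus_factor_simple:
  assumes x: "x \<in> {a + 1<..<a ^ 2 + 1}" "Freal a (- x) < 0"
  shows "\<exists>t. (\<forall>k. a ^ k \<le> t k \<and> t k \<le> (a ^ 2 + 1) * a ^ k) \<and>
     (\<forall>n. \<exists>h. h holomorphic_on UNIV \<and> (\<forall>z. F a (- z) = (\<Prod>k<n. (1 - z / of_real (t k))) * h z))"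
proof -
  have x1: "x \<ge> 1" using x a by auto
  have "\<exists>t. x * a ^ k / a < t \<and> t < x * a ^ k \<and> Freal a (- t) = 0" for k
  proof (cases k)
    case 0
    \<comment> \<open>From x < a^2 + 1 it follows that x / a lies in the range up to a + 1, where
      F(-y) is positive.\<close>
    have "a ^ 2 + 1 < a * (a + 1)" using a by (simp add: power2_eq_square algebra_simps)
    hence "x / a \<le> a + 1" using x a by (auto simp: field_simps)
    hence "Freal a (- (x / a)) > 0" using x1 a by (intro Freal_minus_pos[OF a]) auto
    hence "Freal a (- (x / a)) * Freal a (- x) < 0" using x by (intro mult_pos_neg)
    moreover have "x / a < x" using x1 a by (simp add: divide_less_eq)
    ultimately show ?thesis
      using Freal_minus_zero_between[of "x / a" x] 0 by simp
  next
    case (Suc j)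
    show ?thesis
    proof (cases j)
      case 0
      have "Freal a (- (x * a)) \<ge> 2" using Freal_minus_alternating[OF x1, of 0] x by simp
      hence "Freal a (- x) * Freal a (- (x * a)) < 0" using x by (intro mult_neg_pos) auto
      thus ?thesis using Freal_minus_zero_between[of x "x * a"] x1 a Suc 0 by simp
    next
      case (Suc i)
      thus ?thesis using Freal_minus_zero_in_gap[OF x1, of i] x \<open>k = Suc j\<close> a by simp
    qed
  qed
  then obtain t where "\<forall>k. x * a ^ k / a < t k \<and> t k < x * a ^ k \<and> Freal a (- t k) = 0"
    using choice[of "\<lambda>k t. x * a ^ k / a < t \<and> t < x * a ^ k \<and> Freal a (- t) = 0"] by auto
  hence t: "x * a ^ k / a < t k" "t k < x * a ^ k" "Freal a (- t k) = 0" for k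
    by auto
  have "strict_mono t"
    unfolding strict_mono_Suc_iff
  proof
    fix k
    show "t k < t (Suc k)" using t(2)[of k] t(1)[of "Suc k"] a by simp
  qed
  have lo: "a ^ k \<le> t k" for k
  proof -
    have "a * a ^ k \<le> x * a ^ k" using x a by (intro mult_right_mono) auto
    hence "a ^ k \<le> x * a ^ k / a" using a by (simp add: field_simps)
    with t(1)[of k] show ?thesis by simp
  qed
  have hi: "t k \<le> (a ^ 2 + 1) * a ^ k" for k
  proof -
    have "x * a ^ k \<le> (a ^ 2 + 1) * a ^ k" using x a by (intro mult_right_mono) auto
    with t(2)[of k] show ?thesis by simp
  qed
  have "t k > 0" for k using less_le_trans[OF zero_less_power lo[of k]] a by simp
  hence "t k \<noteq> 0" for k by (rule less_imp_neq[symmetric])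
  hence "\<exists>h. h holomorphic_on UNIV \<and> (\<forall>z. F a (- z) = (\<Prod>k<n. (1 - z / of_real (t k))) * h z)" for n
    using strict_mono_imp_inj_on[OF \<open>strict_mono t\<close>] t(3)
    by (intro entire_factor_zero_seq F_minus_holomorphic) (auto simp: F_minus_of_real intro: inj_on_subset)
  with lo hi show ?thesis by (intro exI[of _ t] conjI allI)
qed

text \<open>As F(-y) = (1 - y/x) h(y) is nonnegative on both sides of x, h is nonnegative to the
  left and nonpositive to the right, and continuity makes it vanish at x.\<close>

lemma F_minus_double_zero:
  assumes x: "x \<in> {a + 1<..<a ^ 2 + 1}" "Freal a (- x) = 0"
    and nonneg: "\<And>y. y \<in> {a + 1<..<a ^ 2 + 1} \<Longrightarrow> Freal a (- y) \<ge> 0"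
    and h: "h holomorphic_on UNIV" "\<And>z. F a (- z) = (1 - z / of_real x) * h z"
  shows "h (of_real x) = 0"
proof -
  have x0: "x > 0" using x a by auto
  have "continuous_on UNIV (\<lambda>y. h (of_real y))"
    by (intro continuous_on_compose2[OF holomorphic_on_imp_continuous_on[OF h(1)]] continuous_intros) auto
  hence lim: "((\<lambda>y. h (of_real y)) \<longlongrightarrow> h (of_real x)) (at x)"
    by (simp add: continuous_on_eq_continuous_at isCont_def)
  hence lim_left: "((\<lambda>y. h (of_real y)) \<longlongrightarrow> h (of_real x)) (at_left x)"
    and lim_right: "((\<lambda>y. h (of_real y)) \<longlongrightarrow> h (of_real x)) (at_right x)"
    by (simp_all only: filterlim_at_split)
  have val: "complex_of_real (Freal a (- y)) = of_real (1 - y / x) * h (of_real y)" for y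
    using h(2)[of "of_real y"] F_minus_of_real[of y] by simp
  have Re: "Freal a (- y) = (1 - y / x) * Re (h (of_real y))"
    and Im: "(1 - y / x) * Im (h (of_real y)) = 0" for y
    using arg_cong[OF val[of y], of Re] arg_cong[OF val[of y], of Im] by simp_all
  have "Re (h (of_real x)) \<ge> 0"
  proof (rule tendsto_lowerbound)
    show "((\<lambda>y. Re (h (of_real y))) \<longlongrightarrow> Re (h (of_real x))) (at_left x)"
      by (rule tendsto_Re[OF lim_left])
    have "eventually (\<lambda>y. y \<in> {a + 1<..<x}) (at_left x)"
      using x by (intro eventually_at_left_real) auto
    thus "eventually (\<lambda>y. 0 \<le> Re (h (of_real y))) (at_left x)"
    proof eventually_elim
      case (elim y)
      hence "1 - y / x > 0" "Freal a (- y) \<ge> 0" using x0 x by (auto intro!: nonneg)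
      thus ?case using Re[of y] by (simp add: zero_le_mult_iff)
    qed
  qed simp
  moreover have "Re (h (of_real x)) \<le> 0"
  proof (rule tendsto_upperbound)
    show "((\<lambda>y. Re (h (of_real y))) \<longlongrightarrow> Re (h (of_real x))) (at_right x)"
      by (rule tendsto_Re[OF lim_right])
    have "eventually (\<lambda>y. y \<in> {x<..<a ^ 2 + 1}) (at_right x)"
      using x by (intro eventually_at_right_real) auto
    thus "eventually (\<lambda>y. Re (h (of_real y)) \<le> 0) (at_right x)"
    proof eventually_elim
      case (elim y)
      hence "1 - y / x < 0" "Freal a (- y) \<ge> 0" using x0 x by (auto intro!: nonneg)
      thus ?case using Re[of y] by (simp add: zero_le_mult_iff)
    qed
  qed simp
  moreover have "Im (h (of_real x)) = 0"
  proof (rule tendsto_unique[OF _ tendsto_Im[OF lim]])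
    have "Im (h (of_real y)) = 0" if "y \<noteq> x" for y
      using Im[of y] that x0 by simp
    hence "eventually (\<lambda>y. Im (h (of_real y)) = 0) (at x)"
      unfolding eventually_at_filter by simp
    thus "((\<lambda>y. Im (h (of_real y))) \<longlongrightarrow> 0) (at x)" by (rule tendsto_eventually)
  qed simp
  ultimately show ?thesis by (simp add: complex_eq_iff)
qed

text \<open>Here F touches zero at -x without becoming negative nearby, so x enters the list twice.
  The other zeros lie in the gaps from x a^(k+1) to x a^(k+2).\<close>

lemma F_minus_factor_double:
  assumes x: "x \<in> {a + 1<..<a ^ 2 + 1}" "Freal a (- x) = 0"
    and nonneg: "\<And>y. y \<in> {a + 1<..<a ^ 2 + 1} \<Longrightarrow> Freal a (- y) \<ge> 0"
  shows "\<exists>t. (\<forall>k. a ^ k \<le> t k \<and> t k \<le> (a ^ 2 + 1) * a ^ k) \<and>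
     (\<forall>n. \<exists>h. h holomorphic_on UNIV \<and> (\<forall>z. F a (- z) = (\<Prod>k<n. (1 - z / of_real (t k))) * h z))"
proof -
  have x1: "x \<ge> 1" using x a by auto
  have "\<forall>k. \<exists>t. x * a ^ Suc k < t \<and> t < x * a ^ Suc (Suc k) \<and> Freal a (- t) = 0"
    using Freal_minus_zero_in_gap[OF x1] x(2) by simp
  then obtain u where "\<forall>k. x * a ^ Suc k < u k \<and> u k < x * a ^ Suc (Suc k) \<and> Freal a (- u k) = 0"
    using choice[of "\<lambda>k t. x * a ^ Suc k < t \<and> t < x * a ^ Suc (Suc k) \<and> Freal a (- t) = 0"] by auto
  hence u: "x * a ^ Suc k < u k" "u k < x * a ^ Suc (Suc k)" "Freal a (- u k) = 0" for k
    by auto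
  \<comment> \<open>\<open>s\<close> lists distinct zeros of the quotient of F(-z) by 1 - z/x,
    beginning with x itself; \<open>t\<close> puts the first copy of x in front. Since only distinct
    zeros can be split off at once, the division is done in two rounds.\<close>
  define s where "s k = (case k of 0 \<Rightarrow> x | Suc j \<Rightarrow> u j)" for k
  define t where "t k = (case k of 0 \<Rightarrow> x | Suc j \<Rightarrow> s j)" for k
  have s_bounds: "x * a ^ k \<le> s k \<and> s k \<le> x * a ^ Suc k" for k
  proof (cases k)
    case (Suc j)
    thus ?thesis using u(1,2)[of j] by (simp add: s_def less_imp_le)
  qed (use a x1 in \<open>simp add: s_def\<close>)
  hence s_lo: "x * a ^ k \<le> s k" and s_hi: "s k \<le> x * a ^ Suc k" for k
    by blast+
  have "strict_mono s"
    unfolding strict_mono_Suc_iff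
  proof
    fix k
    have "s k \<le> x * a ^ Suc k" by (rule s_hi)
    also have "\<dots> < s (Suc k)" using u(1)[of k] by (simp add: s_def)
    finally show "s k < s (Suc k)" .
  qed
  \<comment> \<open>The additional power of a, which comes from x > a, offsets the index shift
    \<open>t (Suc k) = s k\<close>.\<close>
  have s_ge: "a * a ^ k \<le> s k" for k
  proof -
    have "a * a ^ k \<le> x * a ^ k" using x a by (intro mult_right_mono) auto
    with s_lo[of k] show ?thesis by simp
  qed
  have lo: "a ^ k \<le> t k" for k
    using s_ge[of "k - 1"] x1 by (cases k) (auto simp: t_def)
  have hi: "t k \<le> (a ^ 2 + 1) * a ^ k" for k
  proof (cases k)
    case (Suc j)
    have "x * a ^ Suc j \<le> (a ^ 2 + 1) * a ^ Suc j" using x a by (intro mult_right_mono) auto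
    with s_hi[of j] Suc show ?thesis by (simp add: t_def)
  qed (use x in \<open>auto simp: t_def\<close>)
  obtain h1 where h1: "h1 holomorphic_on UNIV" "\<And>z. F a (- z) = (1 - z / of_real x) * h1 z"
    using entire_factor_zeros[of "{of_real x}" "\<lambda>z. F a (- z)"] F_minus_holomorphic x x1
    by (auto simp: F_minus_of_real)
  have "h1 (of_real x) = 0" using F_minus_double_zero[OF x nonneg h1] by simp
  have s_zero: "h1 (of_real (s k)) = 0" for k
  proof (cases k)
    case (Suc j)
    have "x * 1 < x * a ^ Suc j" using x1 a by (intro mult_strict_left_mono) (simp_all del: power_Suc)
    hence "x < s k" using u(1)[of j] by (simp add: s_def Suc)
    hence "s k \<noteq> x" "x \<noteq> 0" using x1 by auto
    moreover have "F a (- of_real (s k)) = 0" by (simp add: F_minus_of_real s_def Suc u(3))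
    ultimately show ?thesis using h1(2)[of "of_real (s k)"] by simp
  qed (simp add: s_def \<open>h1 (of_real x) = 0\<close>)
  have "s k > 0" for k using s_ge[of k] a by (intro less_le_trans[OF _ s_ge[of k]]) simp
  hence s_nz: "s k \<noteq> 0" for k by (rule less_imp_neq[symmetric])
  have "\<exists>h. h holomorphic_on UNIV \<and> (\<forall>z. F a (- z) = (\<Prod>k<n. (1 - z / of_real (t k))) * h z)" for n
  proof (cases n)
    case 0
    show ?thesis
      unfolding 0 by (rule exI[of _ "\<lambda>z. F a (- z)"]) (simp add: F_minus_holomorphic)
  next
    case (Suc m)
    have "\<exists>h. h holomorphic_on UNIV \<and> (\<forall>z. h1 z = (\<Prod>k<m. (1 - z / of_real (s k))) * h z)"
      using h1(1) s_zero s_nz strict_mono_imp_inj_on[OF \<open>strict_mono s\<close>]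
      by (intro entire_factor_zero_seq) (auto intro: inj_on_subset)
    then obtain h where h: "h holomorphic_on UNIV" "\<forall>z. h1 z = (\<Prod>k<m. (1 - z / of_real (s k))) * h z"
      by (elim exE conjE)
    have "F a (- z) = (\<Prod>k<n. (1 - z / of_real (t k))) * h z" for z
    proof -
      have "F a (- z) = (1 - z / of_real x) * ((\<Prod>k<m. (1 - z / of_real (s k))) * h z)"
        using h(2) by (simp only: h1(2))
      also have "\<dots> = (\<Prod>k<n. (1 - z / of_real (t k))) * h z"
        unfolding Suc prod.lessThan_Suc_shift by (simp add: t_def)
      finally show ?thesis .
    qed
    with h(1) show ?thesis by (intro exI[of _ h] conjI allI)
  qed
  with lo hi show ?thesis by (intro exI[of _ t] conjI allI)
qed

text \<open>Either F(-y) is negative somewhere in the interval, or it is nonnegative throughout and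
  its zero x there is double.\<close>

lemma F_minus_factor:
  assumes "x \<in> {a + 1<..<a ^ 2 + 1}" "Freal a (- x) \<le> 0"
  shows "\<exists>t. (\<forall>k. a ^ k \<le> t k \<and> t k \<le> (a ^ 2 + 1) * a ^ k) \<and>
     (\<forall>n. \<exists>h. h holomorphic_on UNIV \<and> (\<forall>z. F a (- z) = (\<Prod>k<n. (1 - z / of_real (t k))) * h z))"
proof (cases "\<exists>y\<in>{a + 1<..<a ^ 2 + 1}. Freal a (- y) < 0")
  case True
  then obtain y where "y \<in> {a + 1<..<a ^ 2 + 1}" "Freal a (- y) < 0" by blast
  thus ?thesis by (rule F_minus_factor_simple)
next
  case False
  hence nonneg: "Freal a (- y) \<ge> 0" if "y \<in> {a + 1<..<a ^ 2 + 1}" for y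
    using that not_le by blast
  hence "Freal a (- x) = 0" using assms by (intro antisym) auto
  from F_minus_factor_double[OF assms(1) this nonneg] show ?thesis .
qed

end

section \<open>Convergence of the quotients to a polynomial of degree at most 1\<close>

context
  fixes a :: real
  assumes a: "a > 3"
begin

text \<open>This ratio, called \<open>s\<close> below, bounds t_k / a^(n+2) for all k < n, that is,
  the first n zeros relative to the radius of the circle. Being less than 1/2, it makes s / (1 - s)
  less than 1.\<close>

lemma zero_radius_ratio_bounds:
  "0 < (a ^ 2 + 1) / a ^ 3" "(a ^ 2 + 1) / a ^ 3 < 1 / 2"
proof -
  have "3 * 3 < a * a" using a by (intro mult_strict_mono) auto
  moreover have "3 * a ^ 2 < a * a ^ 2" using a by (intro mult_strict_right_mono) auto
  ultimately have "2 * (a ^ 2 + 1) < a ^ 3" by (simp add: power2_eq_square power3_eq_cube)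
  thus "(a ^ 2 + 1) / a ^ 3 < 1 / 2" using a by (simp add: field_simps)
  show "0 < (a ^ 2 + 1) / a ^ 3" using a by (simp add: add_pos_pos)
qed

text \<open>With q = a^2 + 1, on the circle |1 - z/t_k| \<ge> |z|/t_k - 1 \<ge> (1 - s) |z| / (q
  a^k), because |z| / (q a^k) is at least 1/s. Dividing the growth bound for F by the product of
  these leaves a^2 s / (1 - s) per factor.\<close>

lemma quotient_bound_on_sphere:
  fixes t :: "nat \<Rightarrow> real"
  assumes t: "\<And>k. a ^ k \<le> t k" "\<And>k. t k \<le> (a ^ 2 + 1) * a ^ k"
    and h: "F a (- z) = (\<Prod>k<n. (1 - z / of_real (t k))) * h"
    and z: "norm z = a ^ (n + 2)"
  defines "s \<equiv> (a ^ 2 + 1) / a ^ 3"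
  shows "norm h \<le> Freal a (a ^ 2) * (a ^ 2 * (s / (1 - s))) ^ n"
proof -
  define B where "B = a ^ 2 + 1"
  have B: "B > 0" using a by (simp add: B_def add_pos_pos)
  have s: "s = B / a ^ 3" by (simp add: s_def B_def)
  have s0: "0 < s" and s1: "s < 1 / 2"
    using zero_radius_ratio_bounds by (simp_all add: s_def)
  have tpos: "t k > 0" for k
    using t(1)[of k] a by (intro less_le_trans[OF _ t(1)[of k]]) simp
  have fac: "(1 - s) * a ^ (n - Suc k + 3) / B \<le> norm (1 - z / of_real (t k))" if k: "k < n" for k
  proof -
    define X where "X = a ^ (n - Suc k + 3) / B"
    have "n + 2 = k + (n - Suc k + 3)" using k by simp
    hence nz: "norm z = a ^ k * a ^ (n - Suc k + 3)" by (simp only: z power_add)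
    have "a ^ 3 \<le> a ^ (n - Suc k + 3)" using a by (intro power_increasing) auto
    hence "s * X \<ge> 1" using a B by (simp add: s X_def)
    have "X = norm z / (B * a ^ k)" using a by (simp add: X_def nz)
    also have "\<dots> \<le> norm z / t k"
      using t(2)[of k] tpos[of k] by (intro divide_left_mono) (auto simp: B_def intro!: mult_pos_pos add_pos_pos)
    finally have "X \<le> norm z / t k" .
    have "(1 - s) * X \<le> norm z / t k - 1"
      using \<open>X \<le> norm z / t k\<close> \<open>s * X \<ge> 1\<close> by (simp add: algebra_simps)
    also have "\<dots> = norm (z / of_real (t k)) - norm (1 :: complex)"
      using tpos[of k] by (simp add: norm_divide)
    also have "\<dots> \<le> norm (z / of_real (t k) - 1)" by (rule norm_triangle_ineq2)
    finally show ?thesis by (simp add: X_def norm_minus_commute)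
  qed
  define P where "P = (\<Prod>k<n. (1 - s) * a ^ (k + 3) / B)"
  have P: "P > 0" unfolding P_def using s1 a B by (intro prod_pos) auto
  \<comment> \<open>Reversing the index pairs the lower bounds with the factors
    \<open>a ^ (k + 2)\<close> of the growth bound in such a way that their quotient is independent
    of k.\<close>
  have "P = (\<Prod>k<n. (1 - s) * a ^ (n - Suc k + 3) / B)"
    unfolding P_def by (rule prod.nat_diff_reindex[symmetric])
  also have "\<dots> \<le> (\<Prod>k<n. norm (1 - z / of_real (t k)))"
    using fac s1 a B by (intro prod_mono) auto
  also have "\<dots> = norm (\<Prod>k<n. (1 - z / of_real (t k)))" by (rule prod_norm)
  finally have "P * norm h \<le> norm (F a (- z))"
    unfolding h norm_mult by (intro mult_right_mono) auto
  also have "\<dots> \<le> Freal a (a ^ (n + 2))"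
    using norm_F_le[of a "- z"] a z by simp
  also have "\<dots> \<le> Freal a (a ^ 2) * (\<Prod>k<n. a ^ (k + 2))"
  proof (rule Freal_power_le)
    have "3 * a < a * a" using a by (intro mult_strict_right_mono) auto
    thus "a + 1 \<le> a ^ 2" unfolding power2_eq_square using a by linarith
  qed (use a in simp)
  finally have "norm h \<le> Freal a (a ^ 2) * (\<Prod>k<n. a ^ (k + 2)) / P"
    using P by (simp add: field_simps)
  also have "\<dots> = Freal a (a ^ 2) * (\<Prod>k<n. a ^ (k + 2) / ((1 - s) * a ^ (k + 3) / B))"
    by (simp only: P_def prod_dividef times_divide_eq_right)
  also have "(\<Prod>k<n. a ^ (k + 2) / ((1 - s) * a ^ (k + 3) / B)) = (\<Prod>k<n. a ^ 2 * (s / (1 - s)))"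
  proof (rule prod.cong[OF refl])
    fix k
    have "a ^ (k + 2) / ((1 - s) * a ^ (k + 3) / B) = B / ((1 - s) * a)"
      using a by (simp add: power_add power2_eq_square power3_eq_cube)
    also have "\<dots> = a ^ 2 * (s / (1 - s))"
      using a by (simp add: s power2_eq_square power3_eq_cube)
    finally show "a ^ (k + 2) / ((1 - s) * a ^ (k + 3) / B) = a ^ 2 * (s / (1 - s))" .
  qed
  finally show "norm h \<le> Freal a (a ^ 2) * (a ^ 2 * (s / (1 - s))) ^ n" by simp
qed

text \<open>At 0 the logarithmic derivative of F(-z) is -1/(a + 1), and the first n factors
  contribute minus the sum of the 1/t_k; h accounts for the difference.\<close>

lemma deriv_quotient_at_0:
  fixes t :: "nat \<Rightarrow> real"
  assumes t: "\<And>k. t k \<noteq> 0" and h: "h holomorphic_on UNIV"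
    "\<And>z. F a (- z) = (\<Prod>k<n. (1 - z / of_real (t k))) * h z"
  shows "h 0 = 1" and "deriv h 0 = of_real ((\<Sum>k<n. 1 / t k) - 1 / (a + 1))"
proof -
  have a1: "a > 1" using a by simp
  have "F a 0 = 1" using F_of_real[OF a1, of 0] Freal_0[OF a1] by simp
  thus h0: "h 0 = 1" using h(2)[of 0] by simp
  have dh: "(h has_field_derivative deriv h 0) (at 0)"
    using h(1) by (rule holomorphic_derivI) auto
  have "((\<lambda>z. \<Prod>k<n. (1 - z / of_real (t k))) has_field_derivative
      (\<Sum>k<n. - (1 / of_real (t k)) * (\<Prod>j\<in>{..<n} - {k}. (1 - 0 / of_real (t j))))) (at (0 :: complex))"
    by (rule has_field_derivative_prod) (use t in \<open>auto intro!: derivative_eq_intros\<close>)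
  hence "((\<lambda>z. \<Prod>k<n. (1 - z / of_real (t k))) has_field_derivative - of_real (\<Sum>k<n. 1 / t k)) (at (0 :: complex))"
    by (simp add: sum_negf)
  from DERIV_mult[OF this dh]
  have "((\<lambda>z. F a (- z)) has_field_derivative deriv h 0 - of_real (\<Sum>k<n. 1 / t k)) (at 0)"
    unfolding h(2) using h0 by (simp add: algebra_simps)
  moreover have "((\<lambda>z. F a (- z)) has_field_derivative of_real (1 / (a + 1)) * (- 1)) (at 0)"
    by (rule DERIV_chain2[of "F a" _ "\<lambda>z. - z"])
       (use F_has_derivative_0[OF a1] in \<open>auto intro!: derivative_eq_intros\<close>)
  ultimately have "deriv h 0 - of_real (\<Sum>k<n. 1 / t k) = of_real (1 / (a + 1)) * (- 1)"
    by (rule DERIV_unique)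
  thus "deriv h 0 = of_real ((\<Sum>k<n. 1 / t k) - 1 / (a + 1))"
    unfolding of_real_diff by (simp only: diff_eq_eq mult_minus_right mult_1_right) simp
qed

text \<open>In Cauchy's estimate on the circle of radius R = a^(n+2), the growth a^(2n) of the
  quotient is cancelled by R^2, so the nonlinear part of h_n(z) is O((s / (1 - s))^n). Hence h_n(z)
  tends to 1 + (T - 1/(a + 1)) z, where T is the sum of the 1/t_k.\<close>

lemma F_product_representation:
  fixes t :: "nat \<Rightarrow> real" and h :: "nat \<Rightarrow> complex \<Rightarrow> complex"
  assumes t: "\<And>k. a ^ k \<le> t k" "\<And>k. t k \<le> (a ^ 2 + 1) * a ^ k"
    and h: "\<And>n. h n holomorphic_on UNIV"
      "\<And>n z. F a (- z) = (\<Prod>k<n. (1 - z / of_real (t k))) * h n z"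
  shows "summable (\<lambda>k. 1 / t k)"
    and "(\<lambda>n. (1 + of_real ((\<Sum>k. 1 / t k) - 1 / (a + 1)) * z) * (\<Prod>k<n. (1 - z / of_real (t k)))) \<longlonglongrightarrow> F a (- z)"
proof -
  have tpos: "t k > 0" for k
    using t(1)[of k] a by (intro less_le_trans[OF _ t(1)[of k]]) simp
  have tn0: "t k \<noteq> 0" for k using tpos[of k] by simp
  show sm: "summable (\<lambda>k. 1 / t k)"
  proof (rule summable_comparison_test')
    show "summable (\<lambda>k. (1 / a) ^ k)" using a by (intro summable_geometric) simp
    show "norm (1 / t k) \<le> (1 / a) ^ k" for k
      using t(1)[of k] tpos[of k] a by (simp add: power_one_over frac_le)
  qed
  define T where "T = (\<Sum>k. 1 / t k)"
  define s where "s = (a ^ 2 + 1) / a ^ 3"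
  define K where "K = Freal a (a ^ 2)"
  define b where "b n = (\<Sum>k<n. 1 / t k) - 1 / (a + 1)" for n
  define G where "G n = (\<Prod>k<n. (1 - z / of_real (t k)))" for n
  have s: "0 < s" "s < 1 / 2"
    using zero_radius_ratio_bounds by (simp_all add: s_def)
  have K: "K \<ge> 1" unfolding K_def using a by (intro Freal_ge_1) auto
  \<comment> \<open>A bound uniform in n ensures that the product of \<open>G\<close> with a null
    sequence is again a null sequence.\<close>
  have Gbound: "norm (G n) \<le> exp (norm z * T)" for n
  proof -
    have "norm (G n) = (\<Prod>k<n. norm (1 - z / of_real (t k)))" unfolding G_def by (rule prod_norm[symmetric])
    also have "\<dots> \<le> (\<Prod>k<n. 1 + norm z * (1 / t k))"
    proof (intro prod_mono conjI)
      fix k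
      show "norm (1 - z / of_real (t k)) \<le> 1 + norm z * (1 / t k)"
        using norm_triangle_ineq4[of 1 "z / of_real (t k)"] tpos[of k] by (simp add: norm_divide)
    qed auto
    also have "\<dots> \<le> exp (\<Sum>k<n. norm z * (1 / t k))"
      using tpos by (intro prod_le_exp_sum) (simp add: less_imp_le)
    also have "(\<Sum>k<n. norm z * (1 / t k)) = norm z * (\<Sum>k<n. 1 / t k)"
      by (rule sum_distrib_left[symmetric])
    also have "(\<Sum>k<n. 1 / t k) \<le> T"
      unfolding T_def using tpos by (intro sum_le_suminf sm) (auto simp: less_imp_le)
    finally show ?thesis by (simp add: mult_left_mono)
  qed
  define \<epsilon> where "\<epsilon> n = h n z - 1 - of_real (b n) * z" for n
  obtain N where N: "2 * norm z < a ^ N" using real_arch_pow[of a] a by auto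
  have "eventually (\<lambda>n. 2 * norm z \<le> a ^ n) sequentially"
    using eventually_ge_at_top[of N]
  proof eventually_elim
    case (elim n)
    hence "a ^ N \<le> a ^ n" using a by (intro power_increasing) auto
    with N show ?case by simp
  qed
  hence "eventually (\<lambda>n. norm (\<epsilon> n) \<le> 2 * K * norm z ^ 2 * (s / (1 - s)) ^ n) sequentially"
  proof eventually_elim
    case (elim n)
    define R where "R = a ^ (n + 2)"
    have R: "R > 0" using a by (simp add: R_def)
    have "R \<ge> a ^ n" unfolding R_def using a by (intro power_increasing) auto
    have hR: "norm (h n w) \<le> K * (a ^ 2 * (s / (1 - s))) ^ n" if "norm w = R" for w
      unfolding K_def s_def using quotient_bound_on_sphere[OF t h(2)] that by (simp add: R_def)
    have "norm z \<le> R / 2" using elim \<open>R \<ge> a ^ n\<close> by simp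
    from Cauchy_linear_approx[OF h(1) R hR this]
    have "norm (\<epsilon> n) \<le> 2 * (K * (a ^ 2 * (s / (1 - s))) ^ n) * (norm z / R)\<^sup>2"
      using deriv_quotient_at_0[OF tn0 h(1) h(2), of n] by (simp add: \<epsilon>_def b_def)
    also have "\<dots> = 2 * K * norm z ^ 2 * (s / (1 - s)) ^ n * ((a ^ 2) ^ n / R ^ 2)"
      by (simp add: power_mult_distrib power_divide)
    also have "\<dots> \<le> 2 * K * norm z ^ 2 * (s / (1 - s)) ^ n * 1"
    proof (rule mult_left_mono)
      have "(a ^ 2) ^ n = (a ^ n) ^ 2" by (simp add: power_mult[symmetric] mult.commute)
      also have "\<dots> \<le> R ^ 2" using \<open>R \<ge> a ^ n\<close> a by (intro power_mono) auto
      finally show "(a ^ 2) ^ n / R ^ 2 \<le> 1" using R by simp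
    qed (use K s in auto)
    finally show ?case by simp
  qed
  moreover have "(\<lambda>n. 2 * K * norm z ^ 2 * (s / (1 - s)) ^ n) \<longlonglongrightarrow> 0"
    using s by (intro tendsto_mult_right_zero LIMSEQ_realpow_zero) simp_all
  ultimately have \<epsilon>: "\<epsilon> \<longlonglongrightarrow> 0"
    by (rule Lim_null_comparison)
  have "b \<longlonglongrightarrow> T - 1 / (a + 1)"
    unfolding b_def T_def by (intro tendsto_intros summable_LIMSEQ sm)
  hence "(\<lambda>n. of_real (b n - (T - 1 / (a + 1))) * z + \<epsilon> n) \<longlonglongrightarrow> of_real (T - 1 / (a + 1) - (T - 1 / (a + 1))) * z + 0"
    by (intro tendsto_add tendsto_mult tendsto_of_real tendsto_diff tendsto_const \<epsilon>)
  hence "(\<lambda>n. G n * (of_real (b n - (T - 1 / (a + 1))) * z + \<epsilon> n)) \<longlonglongrightarrow> 0"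
    using Gbound by (intro lim_null_mult_left_bounded[of _ "exp (norm z * T)"]) auto
  \<comment> \<open>Writing the partial products as F(-z) minus a null sequence avoids division and
    so covers the points z where \<open>G\<close> tends to 0.\<close>
  hence "(\<lambda>n. F a (- z) - G n * (of_real (b n - (T - 1 / (a + 1))) * z + \<epsilon> n)) \<longlonglongrightarrow> F a (- z) - 0"
    by (rule tendsto_diff[OF tendsto_const])
  also have "(\<lambda>n. F a (- z) - G n * (of_real (b n - (T - 1 / (a + 1))) * z + \<epsilon> n))
      = (\<lambda>n. (1 + of_real (T - 1 / (a + 1)) * z) * G n)"
  proof
    fix n
    have "F a (- z) = G n * (1 + of_real (b n) * z + \<epsilon> n)"
      using h(2)[of z n] by (simp add: G_def \<epsilon>_def)
    thus "F a (- z) - G n * (of_real (b n - (T - 1 / (a + 1))) * z + \<epsilon> n)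
        = (1 + of_real (T - 1 / (a + 1)) * z) * G n"
      unfolding of_real_diff[of "b n"] by (simp only: algebra_simps)
  qed
  finally show "(\<lambda>n. (1 + of_real ((\<Sum>k. 1 / t k) - 1 / (a + 1)) * z) * (\<Prod>k<n. (1 - z / of_real (t k)))) \<longlonglongrightarrow> F a (- z)"
    by (simp add: T_def G_def)
qed

end

section \<open>From a nonpositive value to the Laguerre-Polya class, and the equivalence\<close>

lemma laguerre_polya_F_if:
  assumes a: "a > 1" and x: "x \<in> {a + 1<..<a ^ 2 + 1}" "Freal a (- x) \<le> 0"
  shows "laguerre_polya (F a)"
proof -
  have a3: "a > 3" using Freal_minus_nonpos_imp[OF a, of x] x a by simp
  from F_minus_factor[OF a x] obtain t
    where "(\<forall>k. a ^ k \<le> t k \<and> t k \<le> (a ^ 2 + 1) * a ^ k) \<and>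
     (\<forall>n. \<exists>h. h holomorphic_on UNIV \<and> (\<forall>z. F a (- z) = (\<Prod>k<n. (1 - z / of_real (t k))) * h z))"
    by (elim exE)
  hence t: "a ^ k \<le> t k" "t k \<le> (a ^ 2 + 1) * a ^ k"
    and ex: "\<forall>n. \<exists>h. h holomorphic_on UNIV \<and> (\<forall>z. F a (- z) = (\<Prod>k<n. (1 - z / of_real (t k))) * h z)" for k
    by simp_all
  from choice[OF ex] obtain h
    where "\<forall>n. h n holomorphic_on UNIV \<and> (\<forall>z. F a (- z) = (\<Prod>k<n. (1 - z / of_real (t k))) * h n z)"
    by (elim exE)
  hence h: "h n holomorphic_on UNIV" "F a (- z) = (\<Prod>k<n. (1 - z / of_real (t k))) * h n z" for n z
    by simp_all
  note rep = F_product_representation[OF a3 t h]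
  show ?thesis
  proof (rule laguerre_polya_if_product[OF F_real_entire[OF a] _ rep(1)])
    show "t k > 0" for k
      using a by (intro less_le_trans[OF _ t(1)[of k]]) simp
    show "(\<lambda>n. (1 - of_real ((\<Sum>k. 1 / t k) - 1 / (a + 1)) * z) * (\<Prod>k<n. (1 + z / of_real (t k)))) \<longlonglongrightarrow> F a z" for z
      using rep(2)[of "- z"] by simp
  qed
qed

theorem theorem1p1:
  fixes a :: real
  assumes "a > 1"
  shows "laguerre_polya (F a) \<longleftrightarrow>
    (\<exists>z\<^sub>0::real. z\<^sub>0 \<in> {-(a^2 + 1)<..<-(a + 1)} \<and> Re (F a (of_real z\<^sub>0)) \<le> 0)"
proof
  assume "laguerre_polya (F a)"
  then obtain x where "x \<in> {a + 1<..<a ^ 2 + 1}" "Freal a (- x) \<le> 0"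
    using laguerre_polya_F_imp[OF assms] by blast
  thus "\<exists>z\<^sub>0::real. z\<^sub>0 \<in> {-(a^2 + 1)<..<-(a + 1)} \<and> Re (F a (of_real z\<^sub>0)) \<le> 0"
    by (intro exI[of _ "- x"]) (simp add: F_minus_of_real[OF assms])
next
  assume "\<exists>z\<^sub>0::real. z\<^sub>0 \<in> {-(a^2 + 1)<..<-(a + 1)} \<and> Re (F a (of_real z\<^sub>0)) \<le> 0"
  then obtain z where "z \<in> {-(a^2 + 1)<..<-(a + 1)}" "Re (F a (of_real z)) \<le> 0" by blast
  thus "laguerre_polya (F a)"
    using laguerre_polya_F_if[OF assms, of "- z"] by (simp add: F_of_real[OF assms])
qed

end
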